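(* Suppose we have MONI (the index described in the context) for a text $T[0..n-1]$ whose Burrows--Wheeler Transform consists of $r$ runs. Given an integer $k \geq 1$ (at construction time), we can add to MONI a data structure (which may depend on $k$) of $O(r \log n)$ bits such that, given at query time any pattern $P[0..m-1]$, we can find the $k$-MEMs of $P$ with respect to $T$ online in $O(\log n)$ time per character of $P$ (and hence in $O(m \log n)$ total time). The constants in the $O$-notation do not depend on $k$.
   Context: Strings are indexed from $0$. The text $T[0..n-1]$ is a string over an ordered alphabet, terminated by a unique end-of-string symbol $\$$ smaller than all other symbols. Bounds are in the word RAM model with words of $\Theta(\log n)$ bits. $k$-MEMs: for an integer $k \geq 1$, a $k$-MEM of $P[0..m-1]$ with respect to $T$ is a non-empty substring $P[i..j]$ (identified by the pair $(i,j)$) that occurs at least $k$ times in $T$ and is maximal with this property, that is, ($i = 0$ or $P[i-1..j]$ occurs fewer than $k$ times in $T$) and ($j = m-1$ or $P[i..j+1]$ occurs fewer than $k$ times in $T$). Suffix array and BWT: $\mathrm{SA}[0..n-1]$ is the suffix array of $T$; $\mathrm{BWT}[q] = T[(\mathrm{SA}[q]-1) \bmod n]$; $\mathrm{LF}$ is the permutation of $\{0,\dots,n-1\}$ with $\mathrm{SA}[\mathrm{LF}(q)] = (\mathrm{SA}[q]-1) \bmod n$. A run is a maximal interval of positions on which BWT is constant; the runs, from left to right, are numbered $0,\dots,r-1$, and run $j$ occupies positions $\mathrm{head}(j)..\mathrm{tail}(j)$. $\mathrm{LCE}(a,b)$ is the length of the longest common prefix of $T[a..n-1]$ and $T[b..n-1]$.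 MONI for $T$ consists of: (1) a table with, for each $j \in \{0,\dots,r-1\}$, the values $\mathrm{head}(j)$, $\mathrm{SA}[\mathrm{head}(j)]$, $\mathrm{tail}(j)$, $\mathrm{SA}[\mathrm{tail}(j)]$, $\mathrm{BWT}[\mathrm{head}(j)]$, $\mu(j)$ and $\mathrm{finger}(j)$, where $\mu(0) < \dots < \mu(r-1)$ are the values $\mathrm{LF}(\mathrm{head}(0)),\dots,\mathrm{LF}(\mathrm{head}(r-1))$ in sorted order and $\mathrm{finger}(j)$ is the number of the run of the BWT containing position $\mu(j)$; the column $\mathrm{BWT}[\mathrm{head}(j)]$ is kept in a wavelet tree; this part takes $O(r \log n)$ bits; and (2) a data structure answering LCE queries on $T$ in $O(\log n)$ time (e.g., a balanced straight-line program for $T$). "Online" means that the characters of $P$ are processed one at a time from $P[m-1]$ to $P[0]$, with the stated time spent per character, and that whether a $k$-MEM starts at position $i$, and which one, is determined once $P[i-1]$ has been processed (once $P[0]$ has been processed, if $i = 0$). *)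

theory Defs
  imports Complex_Main "HOL-Library.List_Lexorder" "HOL-Library.Sublist"
begin

section \<open>Texts, occurrences and k-MEMs\<close>

text \<open>Symbols are natural numbers; in the theorem they are required to fit into a machine word.
  The end-of-string symbol is the last symbol of the text.\<close>

definition is_text :: "nat list \<Rightarrow> bool" where
  "is_text T \<longleftrightarrow> T \<noteq> [] \<and> (\<forall>p < length T - 1. last T < T ! p)"

definition factor :: "nat list \<Rightarrow> nat \<Rightarrow> nat \<Rightarrow> nat list" where
  "factor X i j = take (Suc j - i) (drop i X)"

definition occ :: "nat list \<Rightarrow> nat list \<Rightarrow> nat" where
  "occ X T = card {p. p + length X \<le> length T \<and> take (length X) (drop p T) = X}"

definition kmem :: "nat \<Rightarrow> nat list \<Rightarrow> nat list \<Rightarrow> nat \<Rightarrow> nat \<Rightarrow> bool" where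
  "kmem k T P i j \<longleftrightarrow>
     i \<le> j \<and> j < length P \<and> k \<le> occ (factor P i j) T \<and>
     (i = 0 \<or> occ (factor P (i - 1) j) T < k) \<and>
     (j = length P - 1 \<or> occ (factor P i (j + 1)) T < k)"


section \<open>Suffix array, BWT and the MONI table\<close>

text \<open>The order on suffixes is the lexicographic one of \<open>List_Lexorder\<close>.\<close>

definition sa :: "nat list \<Rightarrow> nat list" where
  "sa T = sort_key (\<lambda>p. drop p T) [0..<length T]"

text \<open>\<open>p - 1\<close> modulo \<open>n\<close>; adding \<open>n\<close> first avoids truncated subtraction.\<close>

definition cyc_pred :: "nat \<Rightarrow> nat \<Rightarrow> nat" where
  "cyc_pred n p = (p + n - 1) mod n"

definition bwt :: "nat list \<Rightarrow> nat list" where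
  "bwt T = map (\<lambda>p. T ! cyc_pred (length T) p) (sa T)"

definition lf :: "nat list \<Rightarrow> nat \<Rightarrow> nat" where
  "lf T q = (THE q'. q' < length T \<and> sa T ! q' = cyc_pred (length T) (sa T ! q))"

definition lce :: "nat list \<Rightarrow> nat \<Rightarrow> nat \<Rightarrow> nat" where
  "lce T a b = length (longest_common_prefix (drop a T) (drop b T))"

definition run_heads :: "nat list \<Rightarrow> nat list" where
  "run_heads T = filter (\<lambda>q. q = 0 \<or> bwt T ! q \<noteq> bwt T ! (q - 1)) [0..<length T]"

definition run_tails :: "nat list \<Rightarrow> nat list" where
  "run_tails T = filter (\<lambda>q. q = length T - 1 \<or> bwt T ! q \<noteq> bwt T ! (q + 1)) [0..<length T]"

definition num_runs :: "nat list \<Rightarrow> nat" where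
  "num_runs T = length (run_heads T)"

definition run_of :: "nat list \<Rightarrow> nat \<Rightarrow> nat" where
  "run_of T q = (THE j. j < num_runs T \<and> run_heads T ! j \<le> q \<and> q \<le> run_tails T ! j)"

definition mus :: "nat list \<Rightarrow> nat list" where
  "mus T = sort (map (lf T) (run_heads T))"

definition fingers :: "nat list \<Rightarrow> nat list" where
  "fingers T = map (run_of T) (mus T)"

definition run_symbols :: "nat list \<Rightarrow> nat list" where
  "run_symbols T = map ((!) (bwt T)) (run_heads T)"


section \<open>Word RAM\<close>

text \<open>A word RAM whose programs are given in structured form. It has word registers, a writable
  memory, and read-only access to the stored index. The index consists of arrays of
  words (the columns of the MONI table and the added data structure) and of the two
  components of MONI that are given only through their queries: the LCE structure, and
  the wavelet tree on the run symbols, which supports access, rank and select.\<close>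

datatype region = Head | Head_SA | Tail | Tail_SA | Mu | Finger | Added

datatype query = LCE | Access | Rank | Select

datatype binop = Add | Sub | Mul | Div | Mod | BitAnd | BitOr | BitXor | Shl | Shr | Less | Equal

type_synonym reg = nat

datatype prog =
    Const reg nat
  | Op binop reg reg reg
  | Fetch region reg reg
  | Load reg reg
  | Store reg reg
  | Query query reg reg reg
  | Seq prog prog
  | IfNZ reg prog prog
  | WhileNZ reg prog

record machine =
  word_length :: nat
  index :: "region \<Rightarrow> nat list"
  answer :: "query \<Rightarrow> nat \<Rightarrow> nat \<Rightarrow> nat"
  query_time :: "query \<Rightarrow> nat \<Rightarrow> nat \<Rightarrow> nat"

record state =
  regs :: "reg \<Rightarrow> nat"
  mem :: "nat \<Rightarrow> nat"

text \<open>Results are reduced modulo \<open>2 ^ w\<close> when they are written to a register. Subtraction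
  therefore wraps around.\<close>

fun apply_op :: "nat \<Rightarrow> binop \<Rightarrow> nat \<Rightarrow> nat \<Rightarrow> nat" where
  "apply_op w Add a b = a + b"
| "apply_op w Sub a b = a + (2 ^ w - b)"
| "apply_op w Mul a b = a * b"
| "apply_op w Div a b = a div b"
| "apply_op w Mod a b = a mod b"
| "apply_op w BitAnd a b = semiring_bit_operations_class.and a b"
| "apply_op w BitOr a b = semiring_bit_operations_class.or a b"
| "apply_op w BitXor a b = semiring_bit_operations_class.xor a b"
| "apply_op w Shl a b = push_bit b a"
| "apply_op w Shr a b = drop_bit b a"
| "apply_op w Less a b = of_bool (a < b)"
| "apply_op w Equal a b = of_bool (a = b)"

definition lookup :: "nat list \<Rightarrow> nat \<Rightarrow> nat" where
  "lookup xs a = (if a < length xs then xs ! a else 0)"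

definition set_reg :: "machine \<Rightarrow> reg \<Rightarrow> nat \<Rightarrow> state \<Rightarrow> state" where
  "set_reg M x v s = s\<lparr>regs := (regs s)(x := v mod 2 ^ word_length M)\<rparr>"

text \<open>\<open>exec M c s t s'\<close>: started in \<open>s\<close>, program \<open>c\<close> halts in \<open>s'\<close> after time \<open>t\<close>.\<close>

inductive exec :: "machine \<Rightarrow> prog \<Rightarrow> state \<Rightarrow> nat \<Rightarrow> state \<Rightarrow> bool" for M :: machine where
  Const: "exec M (Const x v) s 1 (set_reg M x v s)"
| Op: "exec M (Op f x y z) s 1
        (set_reg M x (apply_op (word_length M) f (regs s y) (regs s z)) s)"
| Fetch: "exec M (Fetch R x y) s 1 (set_reg M x (lookup (index M R) (regs s y)) s)"
| Load: "exec M (Load x y) s 1 (set_reg M x (mem s (regs s y)) s)"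
| Store: "exec M (Store x y) s 1 (s\<lparr>mem := (mem s)(regs s x := regs s y)\<rparr>)"
| Query: "exec M (Query Q x y z) s (1 + query_time M Q (regs s y) (regs s z))
           (set_reg M x (answer M Q (regs s y) (regs s z)) s)"
| Seq: "exec M c1 s t1 s1 \<Longrightarrow> exec M c2 s1 t2 s2 \<Longrightarrow> exec M (Seq c1 c2) s (t1 + t2) s2"
| If_nonzero: "regs s x \<noteq> 0 \<Longrightarrow> exec M c1 s t s1 \<Longrightarrow> exec M (IfNZ x c1 c2) s (1 + t) s1"
| If_zero: "regs s x = 0 \<Longrightarrow> exec M c2 s t s1 \<Longrightarrow> exec M (IfNZ x c1 c2) s (1 + t) s1"
| While_zero: "regs s x = 0 \<Longrightarrow> exec M (WhileNZ x c) s 1 s"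
| While_nonzero: "regs s x \<noteq> 0 \<Longrightarrow> exec M c s t1 s1 \<Longrightarrow> exec M (WhileNZ x c) s1 t2 s2 \<Longrightarrow>
    exec M (WhileNZ x c) s (1 + t1 + t2) s2"

lemma exec_deterministic:
  "exec M c s t s1 \<Longrightarrow> exec M c s t' s1' \<Longrightarrow> t = t' \<and> s1 = s1'"
proof (induction arbitrary: t' s1' rule: exec.induct)
  case (Seq c1 s t1 s1 c2 t2 s2)
  from Seq.prems Seq.IH show ?case by (cases rule: exec.cases) blast+
next
  case (If_nonzero s x c1 t s1 c2)
  from If_nonzero.prems If_nonzero.IH If_nonzero.hyps show ?case
    by (cases rule: exec.cases) auto
next
  case (If_zero s x c2 t s1 c1)
  from If_zero.prems If_zero.IH If_zero.hyps show ?case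
    by (cases rule: exec.cases) auto
next
  case (While_nonzero s x c t1 s1 t2 s2)
  from While_nonzero.prems While_nonzero.IH While_nonzero.hyps show ?case
    by (cases rule: exec.cases) blast+
qed (auto elim: exec.cases)


section \<open>MONI with an added data structure\<close>

fun moni_index :: "nat list \<Rightarrow> nat list \<Rightarrow> region \<Rightarrow> nat list" where
  "moni_index T D Head = run_heads T"
| "moni_index T D Head_SA = map ((!) (sa T)) (run_heads T)"
| "moni_index T D Tail = run_tails T"
| "moni_index T D Tail_SA = map ((!) (sa T)) (run_tails T)"
| "moni_index T D Mu = mus T"
| "moni_index T D Finger = fingers T"
| "moni_index T D Added = D"

text \<open>Access ignores its second argument. \<open>Rank\<close> counts the occurrences of symbol \<open>a\<close> among
  the first \<open>b\<close> run symbols; \<open>Select\<close> gives the position of occurrence number \<open>b\<close>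
  (counted from 0) of \<open>a\<close>, or the number of runs if there is none.\<close>

fun moni_answer :: "nat list \<Rightarrow> query \<Rightarrow> nat \<Rightarrow> nat \<Rightarrow> nat" where
  "moni_answer T LCE a b = lce T a b"
| "moni_answer T Access a b = lookup (run_symbols T) a"
| "moni_answer T Rank a b = count_list (take b (run_symbols T)) a"
| "moni_answer T Select a b =
     (let js = filter (\<lambda>j. run_symbols T ! j = a) [0..<num_runs T]
      in if b < length js then js ! b else num_runs T)"

definition moni ::
  "nat \<Rightarrow> nat list \<Rightarrow> (query \<Rightarrow> nat \<Rightarrow> nat \<Rightarrow> nat) \<Rightarrow> nat list \<Rightarrow> machine" where
  "moni w T qt D =
     \<lparr>word_length = w, index = moni_index T D, answer = moni_answer T, query_time = qt\<rparr>"

text \<open>Logarithm used in the bounds; the maximum makes it positive also for \<open>n = 1\<close>.\<close>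

definition lg :: "nat \<Rightarrow> real" where
  "lg n = max 1 (log 2 (real n))"


section \<open>Online processing of a pattern\<close>

text \<open>Initially registers and writable memory are zero. For \<open>i = length P - 1, ..., 0\<close>, symbol
  \<open>P ! i\<close> is put into register 0 and the program \<open>step\<close> is run; all other machine contents persist
  from one symbol to the next. After that run, register 1 holds the answer for position
  \<open>i + 1\<close>. Once \<open>P ! 0\<close> has been processed, the program \<open>finish\<close> leaves the answer for position 0
  in register 1; its time counts towards the symbol \<open>P ! 0\<close>.\<close>

definition online_run ::
  "machine \<Rightarrow> prog \<Rightarrow> prog \<Rightarrow> nat list \<Rightarrow> (nat \<Rightarrow> nat) \<Rightarrow> (nat \<Rightarrow> nat) \<Rightarrow> bool" where
  "online_run M step finish P ans time \<longleftrightarrow>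
     (\<exists>S t s_end t_end.
        S (length P) = \<lparr>regs = (\<lambda>_. 0), mem = (\<lambda>_. 0)\<rparr> \<and>
        (\<forall>i < length P. exec M step (set_reg M 0 (P ! i) (S (Suc i))) (t i) (S i) \<and>
                        ans (Suc i) = regs (S i) 1) \<and>
        exec M finish (S 0) t_end s_end \<and> ans 0 = regs s_end 1 \<and>
        (\<forall>i. time i = t i + (if i = 0 then t_end else 0)))"

text \<open>At most one k-MEM starts at a given position. The answer for position \<open>i\<close> is its length,
  with 0 for \<open>there is none\<close>. Lengths are used instead of end positions because a word
  of \<open>\<Theta>(log n)\<close> bits can hold the length of any substring of the text, but not every
  position of a very long pattern.\<close>

definition correct_answer :: "nat \<Rightarrow> nat list \<Rightarrow> nat list \<Rightarrow> nat \<Rightarrow> nat \<Rightarrow> bool" where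
  "correct_answer k T P i v \<longleftrightarrow> (\<forall>j. kmem k T P i j \<longleftrightarrow> 0 < v \<and> j = i + v - 1)"

definition finds_kmems_online ::
  "machine \<Rightarrow> prog \<Rightarrow> prog \<Rightarrow> nat \<Rightarrow> nat list \<Rightarrow> nat list \<Rightarrow> real \<Rightarrow> bool" where
  "finds_kmems_online M step finish k T P B \<longleftrightarrow>
     (\<exists>ans time. online_run M step finish P ans time \<and>
        (\<forall>i < length P. correct_answer k T P i (ans i)) \<and>
        (\<forall>i < length P. real (time i) \<le> B) \<and>
        real (\<Sum>i < length P. time i) \<le> real (length P) * B)"

end

theory Submission
  imports Defs
begin

text \<open>
  Let \<open>l\<close> be the length of the longest prefix of \<open>P[i..]\<close> that occurs at least \<open>k\<close> times. A \<open>k\<close>-MEM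
  starts at \<open>i\<close> iff \<open>l > 0\<close> and the value for \<open>i - 1\<close> is at most \<open>l\<close>, so it suffices to maintain \<open>l\<close>,
  together with some \<open>q\<close> such that all suffixes at \<open>SA[q..q + k - 1]\<close> start with that prefix.
  To prepend \<open>c\<close>: if positions \<open>q\<close> to \<open>q + k\<close> lie in one BWT run of \<open>c\<close>, then \<open>LF\<close> shifts the whole
  window and \<open>l\<close> grows by 1. Otherwise the suffix array range of the best extendable prefix contains
  a boundary \<open>a\<close> of a \<open>c\<close>-run: one in or next to the window. A run boundary in that range alone
  determines the result, namely \<open>min (\<lambda> a) (1 + min l (LCE (SA[a], SA[q])))\<close>, where \<open>\<lambda> a\<close> is the length of
  the longest prefix of \<open>T[SA[a] - 1..]\<close> with at least \<open>k\<close> occurrences. Storing \<open>\<lambda> a\<close> and the start of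
  the corresponding suffix array range for the \<open>2 r\<close> run boundaries takes \<open>O(r)\<close> words for every \<open>k\<close>.
\<close>

section \<open>Prefixes and the lexicographic order of suffixes\<close>

lemma take_mono_lex: "take m xs \<le> take m ys" if "xs \<le> (ys :: 'a::linorder list)"
  using that
proof (induction m arbitrary: xs ys)
  case (Suc m)
  then show ?case by (cases xs; cases ys) auto
qed simp

text \<open>Truncation to \<open>length X\<close> is monotone, so the truncation of
  \<open>ys\<close> is squeezed between two copies of \<open>X\<close>. This is why suffix array
  ranges are intervals.\<close>

lemma prefix_convex:
  assumes "prefix X xs" "prefix X zs" "xs \<le> ys" "ys \<le> (zs :: 'a::linorder list)"
  shows "prefix X ys"
proof -
  have "take (length X) xs = X" "take (length X) zs = X"
    using assms by (auto simp: prefix_def)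
  then have "take (length X) ys = X"
    using take_mono_lex[OF assms(3), of "length X"] take_mono_lex[OF assms(4), of "length X"] by simp
  then show ?thesis by (metis take_is_prefix)
qed

lemma prefix_take_drop_iff:
  "prefix X xs \<longleftrightarrow> length X \<le> length xs \<and> take (length X) xs = X"
  by (metis append_eq_conv_conj prefix_def prefix_length_le take_is_prefix)

lemma prefix_le_lce:
  assumes "prefix X (drop a T)" "prefix X (drop b T)"
  shows "length X \<le> lce T a b"
  unfolding lce_def using assms longest_common_prefix_max_prefix prefix_length_le by blast

lemma take_drop_eq_of_le_lce:
  assumes "m \<le> lce T a b"
  shows "take m (drop a T) = take m (drop b T)"
proof -
  let ?l = "longest_common_prefix (drop a T) (drop b T)"
  have "take m (drop a T) = take m ?l" "take m (drop b T) = take m ?l"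
    using assms longest_common_prefix_prefix1[of "drop a T" "drop b T"]
      longest_common_prefix_prefix2[of "drop a T" "drop b T"]
    unfolding lce_def prefix_def
    by (metis diff_is_0_eq' append_Nil2 take0 take_append)+
  then show ?thesis by simp
qed

lemma length_sa [simp]: "length (sa T) = length T"
  by (simp add: sa_def)

lemma set_sa [simp]: "set (sa T) = {..<length T}"
  by (auto simp: sa_def)

lemma distinct_sa [simp]: "distinct (sa T)"
  by (simp add: sa_def)

lemma sa_less_length [simp]: "x < length T \<Longrightarrow> sa T ! x < length T"
  using nth_mem[of x "sa T"] by simp

lemma sa_eq_iff: "x < length T \<Longrightarrow> y < length T \<Longrightarrow> sa T ! x = sa T ! y \<longleftrightarrow> x = y"
  by (simp add: nth_eq_iff_index_eq)

lemma sa_mono: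
  assumes "x \<le> y" "y < length T"
  shows "drop (sa T ! x) T \<le> drop (sa T ! y) T"
proof -
  have "sorted (map (\<lambda>p. drop p T) (sa T))"
    by (simp add: sa_def)
  then show ?thesis
    using sorted_nth_mono[of "map (\<lambda>p. drop p T) (sa T)" x y] assms by simp
qed

lemma drop_inj: "a < length T \<Longrightarrow> b < length T \<Longrightarrow> drop a T = drop b T \<Longrightarrow> a = b"
  by (metis diff_diff_cancel length_drop less_imp_le_nat)

lemma sa_strict_mono:
  assumes "x < y" "y < length T"
  shows "drop (sa T ! x) T < drop (sa T ! y) T"
  using sa_mono[of x y T] assms drop_inj[of "sa T ! x" T "sa T ! y"] sa_eq_iff[of x T y]
  by force

lemma sa_less_iff:
  assumes "x < length T" "y < length T"
  shows "drop (sa T ! x) T < drop (sa T ! y) T \<longleftrightarrow> x < y"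
  using sa_strict_mono[of x y T] sa_strict_mono[of y x T] assms
  by (metis less_asym linorder_neqE_nat less_irrefl)

lemma sa_surj: "p < length T \<Longrightarrow> \<exists>x < length T. sa T ! x = p"
  using set_sa[of T] by (metis in_set_conv_nth length_sa lessThan_iff)

section \<open>Suffix array ranges\<close>

definition sa_range :: "nat list \<Rightarrow> nat list \<Rightarrow> nat set" where
  "sa_range T X = {x. x < length T \<and> prefix X (drop (sa T ! x) T)}"

lemma finite_sa_range [simp]: "finite (sa_range T X)"
  by (simp add: sa_range_def)

lemma sa_range_convex:
  assumes "x \<in> sa_range T X" "z \<in> sa_range T X" "x \<le> y" "y \<le> z"
  shows "y \<in> sa_range T X"
  using assms prefix_convex[of X "drop (sa T ! x) T" "drop (sa T ! z) T" "drop (sa T ! y) T"]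
  by (simp add: sa_range_def sa_mono)

lemma sa_range_antimono: "prefix X Y \<Longrightarrow> sa_range T Y \<subseteq> sa_range T X"
  by (auto simp: sa_range_def dest: prefix_order.trans)

text \<open>The suffix array is a bijection onto the text positions. The empty string would have one
  more occurrence, at position \<open>length T\<close>, which has no suffix array entry.\<close>

lemma occ_eq_card:
  assumes "X \<noteq> []"
  shows "occ X T = card (sa_range T X)"
proof -
  have "{p. p + length X \<le> length T \<and> take (length X) (drop p T) = X} = (!) (sa T) ` sa_range T X"
    (is "?L = ?R")
  proof
    show "?L \<subseteq> ?R"
    proof
      fix p assume p: "p \<in> ?L"
      then have "p < length T" using assms by (cases X) auto
      then obtain x where "x < length T" "sa T ! x = p" using sa_surj by blast
      then show "p \<in> ?R" using p by (auto simp: sa_range_def prefix_take_drop_iff)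
    qed
    show "?R \<subseteq> ?L"
    proof
      fix p assume "p \<in> ?R"
      then obtain x where x: "x < length T" "prefix X (drop (sa T ! x) T)" "p = sa T ! x"
        by (auto simp: sa_range_def)
      then have "p < length T" by simp
      then show "p \<in> ?L" using x(2) unfolding x(3)[symmetric] by (auto simp: prefix_take_drop_iff)
    qed
  qed
  moreover have "inj_on ((!) (sa T)) (sa_range T X)"
    by (auto simp: inj_on_def sa_range_def sa_eq_iff)
  ultimately show ?thesis by (simp add: occ_def card_image)
qed

lemma finite_occ: "finite {p. p + length X \<le> length T \<and> take (length X) (drop p T) = X}"
  by (rule finite_subset[of _ "{..length T}"]) auto

lemma occ_antimono:
  assumes "prefix X Y"
  shows "occ Y T \<le> occ X T"
  unfolding occ_def
proof (rule card_mono[OF finite_occ], rule subsetI, clarify)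
  fix p assume p: "p + length Y \<le> length T" "take (length Y) (drop p T) = Y"
  have "take (length X) Y = X" "length X \<le> length Y"
    using assms by (auto simp: prefix_def)
  then show "p + length X \<le> length T \<and> take (length X) (drop p T) = X"
    using p by (metis add_le_cancel_left le_trans min.absorb1 take_take)
qed

text \<open>A convex set with at least \<open>k\<close> elements contains the \<open>k\<close>
  consecutive numbers starting at its minimum.\<close>

lemma sa_range_window:
  assumes "X \<noteq> []" "1 \<le> k" "k \<le> occ X T" and s: "s = Min (sa_range T X)"
  shows "{s..<s + k} \<subseteq> sa_range T X"
proof
  fix x assume x: "x \<in> {s..<s + k}"
  let ?I = "sa_range T X"
  have card: "k \<le> card ?I" using assms occ_eq_card by simp
  then have ne: "?I \<noteq> {}" using assms(2) by auto
  have "?I \<subseteq> {s..Max ?I}" using ne s by auto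
  then have "card ?I \<le> Suc (Max ?I) - s" using card_mono[of "{s..Max ?I}" ?I] by simp
  then have "x \<le> Max ?I" using x card by auto
  then show "x \<in> ?I"
    using sa_range_convex[of s T X "Max ?I" x] ne s x by simp
qed

lemma occ_ge_window:
  assumes "X \<noteq> []" "{s..<s + k} \<subseteq> sa_range T X"
  shows "k \<le> occ X T"
  using card_mono[OF finite_sa_range assms(2)] occ_eq_card[OF assms(1)] by simp

section \<open>Longest prefixes with at least \<open>k\<close> occurrences\<close>

text \<open>Admitting \<open>L = 0\<close> unconditionally keeps the set nonempty for every
  \<open>k\<close>; length 0 then stands for the absence of a match.\<close>

definition mlen :: "nat \<Rightarrow> nat list \<Rightarrow> nat list \<Rightarrow> nat" where
  "mlen k T Z = Max {L. L \<le> length Z \<and> (L = 0 \<or> k \<le> occ (take L Z) T)}"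

text \<open>A prefix occurs at least as often as the whole, so the admissible lengths are downward
  closed and comparing with their maximum is the same as testing membership.\<close>

lemma le_mlen_iff:
  "L \<le> mlen k T Z \<longleftrightarrow> L = 0 \<or> L \<le> length Z \<and> k \<le> occ (take L Z) T"
proof -
  let ?A = "{L. L \<le> length Z \<and> (L = 0 \<or> k \<le> occ (take L Z) T)}"
  have fin: "finite ?A" by simp
  have "mlen k T Z \<in> ?A" unfolding mlen_def by (rule Max_in[OF fin]) auto
  moreover have "prefix (take L Z) (take (mlen k T Z) Z)" if "L \<le> mlen k T Z"
    using that by (metis min.absorb1 take_is_prefix take_take)
  ultimately have "L = 0 \<or> L \<le> length Z \<and> k \<le> occ (take L Z) T" if "L \<le> mlen k T Z"
    using that occ_antimono[of "take L Z" "take (mlen k T Z) Z" T]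
    by (cases "L = 0") (auto intro: le_trans)
  moreover have "L \<le> mlen k T Z" if "L = 0 \<or> L \<le> length Z \<and> k \<le> occ (take L Z) T"
    unfolding mlen_def using that by (intro Max_ge fin) auto
  ultimately show ?thesis by blast
qed

lemma mlen_le_length: "mlen k T Z \<le> length Z"
  using le_mlen_iff[of "mlen k T Z" k T Z] by auto

lemma occ_zero: "length T < length X \<Longrightarrow> occ X T = 0"
  by (auto simp: occ_def)

lemma mlen_le_length_text:
  assumes "1 \<le> k" shows "mlen k T Z \<le> length T"
  using le_mlen_iff[of "mlen k T Z" k T Z] occ_zero[of T "take (mlen k T Z) Z"] assms
  by (cases "length T < mlen k T Z") auto

lemma mlen_zero_if_gt:
  assumes "length T < k" shows "mlen k T Z = 0"
proof (rule ccontr)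
  assume n: "mlen k T Z \<noteq> 0"
  let ?X = "take (mlen k T Z) Z"
  have "k \<le> occ ?X T" using n le_mlen_iff[of "mlen k T Z" k T Z] by simp
  moreover have "?X \<noteq> []" using n mlen_le_length[of k T Z] by auto
  moreover have "card (sa_range T ?X) \<le> length T"
    using card_mono[of "{..<length T}" "sa_range T ?X"] by (auto simp: sa_range_def)
  ultimately show False using assms occ_eq_card[of ?X T] by simp
qed

text \<open>Right maximality forces the length \<open>L\<close> of the match to be the
  \<open>mlen\<close> at \<open>i\<close>. The extension to the left has length
  \<open>Suc L\<close>, so left maximality says that the \<open>mlen\<close> at \<open>i - 1\<close>
  stays below \<open>Suc L\<close>.\<close>

lemma kmem_iff:
  "kmem k T P i j \<longleftrightarrow>
     i < length P \<and> 0 < mlen k T (drop i P) \<and> Suc j = i + mlen k T (drop i P) \<and>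
     (i = 0 \<or> mlen k T (drop (i - 1) P) \<le> mlen k T (drop i P))"
proof (cases "i \<le> j \<and> j < length P")
  case True
  define L where "L = Suc j - i"
  have j: "Suc j = i + L" "0 < L" "i + L \<le> length P" using True by (auto simp: L_def)
  let ?m = "mlen k T (drop i P)"
  have a: "k \<le> occ (factor P i j) T \<longleftrightarrow> L \<le> ?m"
    using j by (auto simp: le_mlen_iff factor_def)
  have b: "occ (factor P i (j + 1)) T < k \<longleftrightarrow> \<not> Suc L \<le> ?m" if "j \<noteq> length P - 1"
    using j that by (auto simp: le_mlen_iff factor_def Suc_diff_le)
  have b': "\<not> Suc L \<le> ?m" if "j = length P - 1"
    using mlen_le_length[of k T "drop i P"] j that by auto
  have c: "occ (factor P (i - 1) j) T < k \<longleftrightarrow> \<not> Suc L \<le> mlen k T (drop (i - 1) P)" if "i \<noteq> 0"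
    using j that True by (auto simp: le_mlen_iff factor_def Suc_diff_le)
  show ?thesis
    unfolding kmem_def using a b b' c j True by (cases "i = 0"; cases "j = length P - 1") auto
next
  case False
  then show ?thesis using mlen_le_length[of k T "drop i P"] by (auto simp: kmem_def)
qed

lemma correct_answerI:
  assumes "i < length P"
    "v = (if 0 < i \<and> mlen k T (drop i P) < mlen k T (drop (i - 1) P) then 0
          else mlen k T (drop i P))"
  shows "correct_answer k T P i v"
  unfolding correct_answer_def kmem_iff using assms by auto

section \<open>The BWT and its runs\<close>

lemma cyc_pred_eq: "p < n \<Longrightarrow> cyc_pred n p = (if p = 0 then n - 1 else p - 1)"
proof (cases p)
  case (Suc p')
  assume "p < n"
  then have "(p + n - 1) = p' + n" "p' < n" using Suc by auto
  then show ?thesis using Suc by (simp add: cyc_pred_def)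
qed (simp add: cyc_pred_def)

lemma filter_shift_eq_map_pred:
  "filter (\<lambda>q. P (Suc q)) [0..<m] = map (\<lambda>q. q - 1) (filter P [1..<Suc m])"
proof -
  have "[1..<Suc m] = map Suc [0..<m]" by (simp add: map_Suc_upt)
  then show ?thesis by (simp add: filter_map o_def del: upt_Suc)
qed

locale indexed_text =
  fixes T :: "nat list" and k :: nat
  assumes is_text: "is_text T" and k_pos: "1 \<le> k"
begin

abbreviation n :: nat where "n \<equiv> length T"
abbreviation r :: nat where "r \<equiv> num_runs T"

lemma n_pos: "0 < n"
  using is_text by (simp add: is_text_def)

lemma last_least: "p < n - 1 \<Longrightarrow> T ! (n - 1) < T ! p"
  using is_text by (auto simp: is_text_def last_conv_nth)

lemma length_bwt [simp]: "length (bwt T) = n"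
  by (simp add: bwt_def)

lemma cyc_pred_less: "cyc_pred n p < n"
  using n_pos by (simp add: cyc_pred_def)

lemma bwt_nth: "x < n \<Longrightarrow> bwt T ! x = T ! cyc_pred n (sa T ! x)"
  by (simp add: bwt_def)

lemma lf_props: "lf T q < n \<and> sa T ! lf T q = cyc_pred n (sa T ! q)"
proof -
  obtain x where x: "x < n" "sa T ! x = cyc_pred n (sa T ! q)"
    using sa_surj cyc_pred_less by metis
  show ?thesis unfolding lf_def
    by (rule theI2[of _ x]) (use x sa_eq_iff[of _ T x] in auto)
qed

lemma drop_cyc_pred:
  assumes "x < n" "sa T ! x \<noteq> 0"
  shows "drop (cyc_pred n (sa T ! x)) T = bwt T ! x # drop (sa T ! x) T"
  using assms bwt_nth[OF assms(1)] cyc_pred_eq[of "sa T ! x" n] sa_less_length[OF assms(1)]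
  by (metis Cons_nth_drop_Suc Suc_pred' cyc_pred_less neq0_conv)

text \<open>The row of text position 0 carries the end-of-string symbol, which occurs only once in
  the text, so no other row shares its BWT symbol.\<close>

lemma bwt_wrap:
  assumes "x < n" "sa T ! x = 0" "y < n" "bwt T ! y = bwt T ! x"
  shows "y = x"
proof -
  have "cyc_pred n (sa T ! y) = n - 1"
  proof (rule ccontr)
    assume "cyc_pred n (sa T ! y) \<noteq> n - 1"
    then have "T ! (n - 1) < T ! cyc_pred n (sa T ! y)"
      using last_least[of "cyc_pred n (sa T ! y)"] cyc_pred_less[of "sa T ! y"] by linarith
    then show False using assms n_pos by (simp add: bwt_nth cyc_pred_eq[of 0 n])
  qed
  then have "sa T ! y = 0"
    using sa_less_length[OF assms(3)] by (auto simp: cyc_pred_eq split: if_splits)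
  then show ?thesis using assms sa_eq_iff[of y T x] by simp
qed

text \<open>Prepending a common symbol preserves the order of two suffixes. A suffix strictly
  between the extended ones would start with the same symbol, and its remainder would lie strictly
  between two adjacent rows.\<close>

lemma lf_Suc:
  assumes "Suc x < n" "bwt T ! Suc x = bwt T ! x"
  shows "lf T (Suc x) = Suc (lf T x)"
proof -
  have nz: "sa T ! x \<noteq> 0" "sa T ! Suc x \<noteq> 0"
    using bwt_wrap[of x "Suc x"] bwt_wrap[of "Suc x" x] assms by auto
  let ?a = "lf T x" and ?b = "lf T (Suc x)" and ?c = "bwt T ! x"
  have a: "?a < n" "drop (sa T ! ?a) T = ?c # drop (sa T ! x) T"
    using lf_props[of x] drop_cyc_pred[of x] nz assms by auto
  have b: "?b < n" "drop (sa T ! ?b) T = ?c # drop (sa T ! Suc x) T"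
    using lf_props[of "Suc x"] drop_cyc_pred[of "Suc x"] nz assms by auto
  have "drop (sa T ! x) T < drop (sa T ! Suc x) T" using assms sa_strict_mono by simp
  then have "drop (sa T ! ?a) T < drop (sa T ! ?b) T" using a b by simp
  then have "?a < ?b" using sa_less_iff[OF a(1) b(1)] by blast
  moreover have "\<not> Suc ?a < ?b"
  proof
    assume "Suc ?a < ?b"
    then have y: "Suc ?a < n" "drop (sa T ! ?a) T < drop (sa T ! Suc ?a) T"
        "drop (sa T ! Suc ?a) T < drop (sa T ! ?b) T"
      using b(1) sa_strict_mono[of ?a "Suc ?a" T] sa_strict_mono[of "Suc ?a" ?b T] by auto
    let ?p = "sa T ! Suc ?a"
    have p: "?p < n" using y by simp
    then obtain d S where S: "drop ?p T = d # S" "S = drop (Suc ?p) T"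
      by (metis Cons_nth_drop_Suc)
    have S': "drop (sa T ! x) T < S" "S < drop (sa T ! Suc x) T"
      using y a b S by auto
    \<comment> \<open>The empty suffix has no row, so the remainder must be nonempty before a row
      can be found for it.\<close>
    have "Suc ?p < n"
    proof (rule ccontr)
      assume "\<not> Suc ?p < n"
      then have "S = []" using S by simp
      then show False using S' by simp
    qed
    then obtain z where "z < n" "sa T ! z = Suc ?p" using sa_surj by blast
    then have "x < z" "z < Suc x" using S' S sa_less_iff[of x T z] sa_less_iff[of z T "Suc x"] assms by auto
    then show False by simp
  qed
  ultimately show ?thesis by simp
qed

section \<open>Heads and tails of the BWT runs\<close>

definition head :: "nat \<Rightarrow> nat" where "head j = run_heads T ! j"
definition tail :: "nat \<Rightarrow> nat" where "tail j = run_tails T ! j"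

lemma run_heads_Cons:
  "run_heads T = 0 # filter (\<lambda>q. q = 0 \<or> bwt T ! q \<noteq> bwt T ! (q - 1)) [1..<n]"
proof -
  have "[0..<n] = 0 # [1..<n]" using n_pos upt_conv_Cons by simp
  then show ?thesis by (simp add: run_heads_def)
qed

text \<open>A tail is the position just before the next head, or the last position;
  \<open>tl\<close> drops the head 0, which has no predecessor.\<close>

lemma run_tails_eq: "run_tails T = map (\<lambda>q. q - 1) (tl (run_heads T) @ [n])"
proof -
  let ?P = "\<lambda>q. q = 0 \<or> bwt T ! q \<noteq> bwt T ! (q - 1)"
  have n: "[0..<n] = [0..<n - 1] @ [n - 1]" using n_pos
    by (metis Suc_pred' upt_Suc_append zero_le)
  have "run_tails T = filter (\<lambda>q. q = n - 1 \<or> bwt T ! q \<noteq> bwt T ! (q + 1)) [0..<n - 1] @ [n - 1]"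
    by (simp add: run_tails_def n)
  also have "filter (\<lambda>q. q = n - 1 \<or> bwt T ! q \<noteq> bwt T ! (q + 1)) [0..<n - 1]
      = filter (\<lambda>q. ?P (Suc q)) [0..<n - 1]"
    by (rule filter_cong) auto
  also have "\<dots> = map (\<lambda>q. q - 1) (filter ?P [1..<Suc (n - 1)])"
    by (rule filter_shift_eq_map_pred)
  also have "Suc (n - 1) = n" using n_pos by simp
  finally show ?thesis by (simp add: run_heads_Cons)
qed

lemma r_pos: "0 < r"
  by (simp add: num_runs_def run_heads_Cons)

lemma r_le_n: "r \<le> n"
  unfolding num_runs_def run_heads_def by (metis diff_zero length_filter_le length_upt)

lemma length_run_tails: "length (run_tails T) = r"
  using r_pos by (simp add: run_tails_eq num_runs_def)

lemma head_0 [simp]: "head 0 = 0"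
  by (simp add: head_def run_heads_Cons)

lemma head_mono: "i < j \<Longrightarrow> j < r \<Longrightarrow> head i < head j"
proof -
  have "sorted_wrt (<) (run_heads T)"
    unfolding run_heads_def by (rule sorted_wrt_filter) simp
  then show "i < j \<Longrightarrow> j < r \<Longrightarrow> head i < head j"
    by (simp add: head_def num_runs_def sorted_wrt_iff_nth_less)
qed

lemma head_less: "j < r \<Longrightarrow> head j < n"
  using nth_mem[of j "run_heads T"] by (auto simp: head_def num_runs_def run_heads_def)

lemma tail_eq: "j < r \<Longrightarrow> tail j = (if Suc j < r then head (Suc j) - 1 else n - 1)"
  by (auto simp: tail_def run_tails_eq nth_append nth_tl num_runs_def head_def)

lemma head_Suc_eq: "Suc j < r \<Longrightarrow> head (Suc j) = Suc (tail j)"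
  using head_mono[of j "Suc j"] by (simp add: tail_eq)

lemma tail_less_head: "i < j \<Longrightarrow> j < r \<Longrightarrow> tail i < head j"
  using head_mono[of "Suc i" j] head_Suc_eq[of i] by (cases "Suc i = j") auto

lemma head_le_tail: "j < r \<Longrightarrow> head j \<le> tail j"
  using head_mono[of j "Suc j"] head_less[of j] by (auto simp: tail_eq)

lemma tail_less: "j < r \<Longrightarrow> tail j < n"
  using head_less[of "Suc j"] n_pos by (auto simp: tail_eq)

text \<open>A change of symbol inside the interval would be a head, but the heads increase and the
  one following \<open>head j\<close> lies beyond \<open>tail j\<close>.\<close>

lemma run_constant:
  assumes "j < r" "head j \<le> x" "x \<le> tail j"
  shows "bwt T ! x = bwt T ! head j"
  using assms(2,3)
proof (induction x rule: dec_induct)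
  case (step x)
  have "Suc x \<notin> set (run_heads T)"
  proof
    assume "Suc x \<in> set (run_heads T)"
    then obtain i where i: "i < r" "head i = Suc x"
      by (auto simp: in_set_conv_nth num_runs_def head_def)
    show False
    proof (cases "j < i")
      case True
      then show False using tail_less_head[of j i] i step by simp
    next
      case False
      then show False using head_mono[of i j] i step assms(1) by (cases "i = j") auto
    qed
  qed
  moreover have "Suc x < n" using tail_less[OF assms(1)] step by simp
  ultimately show ?case using step by (auto simp: run_heads_def)
qed simp

lemma run_containing:
  assumes "x < n"
  obtains j where "j < r" "head j \<le> x" "x \<le> tail j"
proof -
  let ?A = "{j. j < r \<and> head j \<le> x}"
  have A: "finite ?A" "0 \<in> ?A" using r_pos by auto
  let ?j = "Max ?A"
  have j: "?j \<in> ?A" using A Max_in by blast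
  have "x \<le> tail ?j"
  proof (cases "Suc ?j < r")
    case True
    have "Suc ?j \<notin> ?A"
    proof
      assume "Suc ?j \<in> ?A"
      from Max_ge[OF A(1) this] show False by simp
    qed
    then show ?thesis using head_Suc_eq[OF True] True by auto
  next
    case False
    then show ?thesis using j assms by (simp add: tail_eq)
  qed
  then show ?thesis using that j by blast
qed

text \<open>One stored value of \<open>lf\<close> per run therefore determines \<open>lf\<close> on
  the whole run.\<close>

lemma lf_in_run:
  assumes "j < r" "head j \<le> x" "x \<le> tail j"
  shows "lf T x = lf T (head j) + (x - head j)"
  using assms(2,3)
proof (induction x rule: dec_induct)
  case (step x)
  have "Suc x < n" using tail_less[OF assms(1)] step by simp
  moreover have "bwt T ! Suc x = bwt T ! x"
    using run_constant[OF assms(1), of x] run_constant[OF assms(1), of "Suc x"] step by simp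
  ultimately show ?case using lf_Suc[of x] step by (simp add: Suc_diff_le)
qed simp

section \<open>Rank and select on the run symbols\<close>

definition run_symbol :: "nat \<Rightarrow> nat" where "run_symbol j = run_symbols T ! j"

lemma run_symbol_eq: "j < r \<Longrightarrow> run_symbol j = bwt T ! head j"
  by (simp add: run_symbol_def run_symbols_def head_def num_runs_def)

lemma run_symbol_tail: "j < r \<Longrightarrow> run_symbol j = bwt T ! tail j"
  using run_constant[of j "tail j"] head_le_tail by (simp add: run_symbol_eq)

definition rank :: "nat \<Rightarrow> nat \<Rightarrow> nat" where
  "rank a j = moni_answer T Rank a j"

definition select :: "nat \<Rightarrow> nat \<Rightarrow> nat" where
  "select a b = moni_answer T Select a b"

lemma rank_eq: "j \<le> r \<Longrightarrow> rank a j = length (filter (\<lambda>i. run_symbol i = a) [0..<j])"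
proof (induction j)
  case (Suc j)
  then show ?case
    by (simp add: rank_def run_symbol_def take_Suc_conv_app_nth run_symbols_def num_runs_def)
qed (simp add: rank_def)

lemma rank_le: "rank a j \<le> r"
  using count_le_length[of "take j (run_symbols T)" a]
  by (simp add: rank_def run_symbols_def num_runs_def)

lemma select_eq:
  "select a b = (let js = filter (\<lambda>i. run_symbol i = a) [0..<r]
     in if b < length js then js ! b else r)"
  by (simp add: select_def run_symbol_def)

lemma select_le: "select a b \<le> r"
proof -
  let ?js = "filter (\<lambda>i. run_symbol i = a) [0..<r]"
  show ?thesis using nth_mem[of b ?js] by (auto simp: select_eq Let_def)
qed

lemma select_symbol: "select a b < r \<Longrightarrow> run_symbol (select a b) = a"
proof -
  let ?js = "filter (\<lambda>i. run_symbol i = a) [0..<r]"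
  show "select a b < r \<Longrightarrow> run_symbol (select a b) = a"
    using nth_mem[of b ?js] by (auto simp: select_eq Let_def split: if_splits)
qed

text \<open>Exactly \<open>rank a j\<close> of the \<open>a\<close>-runs precede run
  \<open>j\<close>, so with counting from 0 the selected one is the first at or after
  \<open>j\<close>.\<close>

lemma select_rank:
  assumes "j \<le> i" "i < r" "run_symbol i = a"
  shows "j \<le> select a (rank a j)" "select a (rank a j) \<le> i"
proof -
  let ?f = "filter (\<lambda>i. run_symbol i = a)"
  have split: "?f [0..<r] = ?f [0..<j] @ ?f [j..<r]"
    using assms upt_add_eq_append[of 0 j "r - j"] by (simp flip: filter_append)
  have i: "i \<in> set (?f [j..<r])" using assms by simp
  then have ne: "?f [j..<r] \<noteq> []" by (metis empty_iff empty_set)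
  have s: "select a (rank a j) = ?f [j..<r] ! 0"
    using assms ne by (simp add: select_eq split rank_eq nth_append)
  have "sorted (?f [j..<r])" by (rule sorted_filter[of id, simplified]) simp
  moreover obtain x where "x < length (?f [j..<r])" "?f [j..<r] ! x = i"
    using i by (auto simp only: in_set_conv_nth)
  ultimately show "select a (rank a j) \<le> i"
    using s sorted_nth_mono[of "?f [j..<r]" 0 x] by simp
  have "?f [j..<r] ! 0 \<in> set (?f [j..<r])" using ne nth_mem by blast
  then show "j \<le> select a (rank a j)" using s by simp
qed

text \<open>One index lower, the selected run is the last \<open>a\<close>-run before
  \<open>j\<close>.\<close>

lemma select_rank_pred:
  assumes "i < j" "j \<le> r" "run_symbol i = a"
  shows "rank a j > 0" "i \<le> select a (rank a j - 1)" "select a (rank a j - 1) < j"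
proof -
  let ?f = "filter (\<lambda>i. run_symbol i = a)"
  have split: "?f [0..<r] = ?f [0..<j] @ ?f [j..<r]"
    using assms upt_add_eq_append[of 0 j "r - j"] by (simp flip: filter_append)
  have i: "i \<in> set (?f [0..<j])" using assms by simp
  then have ne: "length (?f [0..<j]) > 0" by (metis length_pos_if_in_set)
  then show pos: "rank a j > 0" using assms by (simp add: rank_eq)
  let ?m = "length (?f [0..<j]) - 1"
  have s: "select a (rank a j - 1) = ?f [0..<j] ! ?m"
  proof -
    have "?m < length (?f [0..<r])" using ne unfolding split length_append by linarith
    moreover have "?f [0..<r] ! ?m = ?f [0..<j] ! ?m"
      unfolding split using ne by (simp add: nth_append)
    ultimately show ?thesis using assms by (simp add: select_eq rank_eq)
  qed
  have "sorted (?f [0..<j])" by (rule sorted_filter[of id, simplified]) simp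
  moreover obtain x where "x < length (?f [0..<j])" "?f [0..<j] ! x = i"
    using i by (auto simp only: in_set_conv_nth)
  ultimately show "i \<le> select a (rank a j - 1)"
    using s sorted_nth_mono[of "?f [0..<j]" x ?m] ne by simp
  have "?f [0..<j] ! ?m \<in> set (?f [0..<j])" using ne nth_mem[of ?m "?f [0..<j]"] by simp
  then show "select a (rank a j - 1) < j" using s by simp
qed

section \<open>Prepending a symbol\<close>

text \<open>Only the text position preceding \<open>sa T ! a\<close> matters, so both values can be
  stored per run boundary. \<open>Min\<close> of an empty range is avoided by the
  case distinction.\<close>

definition ext_len :: "nat \<Rightarrow> nat" where
  "ext_len a = mlen k T (drop (cyc_pred n (sa T ! a)) T)"

definition ext_pos :: "nat \<Rightarrow> nat" where
  "ext_pos a = (if ext_len a = 0 then 0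
     else Min (sa_range T (take (ext_len a) (drop (cyc_pred n (sa T ! a)) T))))"

text \<open>The invariant of the search for a pattern suffix \<open>Z\<close>: the suffix array positions
  \<open>q, \<dots>, q + k - 1\<close> lie in the range of the prefix of \<open>Z\<close> of length \<open>l\<close>.
  For \<open>k > n\<close> the window is cut off at \<open>n\<close>, but then \<open>l = 0\<close>.\<close>

definition located :: "nat list \<Rightarrow> nat \<Rightarrow> nat \<Rightarrow> nat \<Rightarrow> bool" where
  "located Z l q p \<longleftrightarrow> l \<le> length Z \<and> q < n \<and> p = sa T ! q \<and> (k \<le> n \<longrightarrow> q + k \<le> n) \<and>
     {q..<q + k} \<inter> {..<n} \<subseteq> sa_range T (take l Z)"

text \<open>The empty prefix puts no constraint on the rows, so a search of length 0 can always
  restart at row 0.\<close>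

lemma located_0: "located Z 0 0 (sa T ! 0)"
  using n_pos by (auto simp: located_def sa_range_def)

lemma located_prefix:
  "located Z l q p \<Longrightarrow> l' \<le> l \<Longrightarrow> q \<le> x \<Longrightarrow> x < q + k \<Longrightarrow> x < n \<Longrightarrow> x \<in> sa_range T (take l' Z)"
proof -
  assume a: "located Z l q p" "l' \<le> l" "q \<le> x" "x < q + k" "x < n"
  then have "x \<in> sa_range T (take l Z)" unfolding located_def by auto
  moreover have "prefix (take l' Z) (take l Z)" using a(2) by (metis min.absorb1 take_is_prefix take_take)
  ultimately show ?thesis using sa_range_antimono by blast
qed

lemma located_q: "located Z l q p \<Longrightarrow> l' \<le> l \<Longrightarrow> q \<in> sa_range T (take l' Z)"
  using located_prefix[of Z l q p l' q] k_pos by (auto simp: located_def)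

lemma cyc_pred_prefix:
  assumes "x < n" "bwt T ! x = c" "x \<in> sa_range T X" "sa T ! x \<noteq> 0 \<or> X = []"
  shows "prefix (c # X) (drop (cyc_pred n (sa T ! x)) T)"
proof (cases "sa T ! x = 0")
  case True
  then show ?thesis
    using assms bwt_nth[OF assms(1)] cyc_pred_less[of "sa T ! x"]
    by (metis Cons_nth_drop_Suc Cons_prefix_Cons Nil_prefix)
next
  case False
  then show ?thesis using assms drop_cyc_pred[of x] by (simp add: sa_range_def)
qed

text \<open>The suffix at \<open>sa T ! a\<close> shares \<open>t - 1\<close> symbols with the one
  at \<open>p\<close>, and that one with \<open>Z\<close>. Hence the text from the preceding
  position shares \<open>t\<close> symbols with \<open>c # Z\<close>, and \<open>ext_len a\<close>
  guarantees \<open>k\<close> occurrences of them.\<close>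

lemma candidate_sound:
  assumes loc: "located Z l q p" and a: "a < n" "bwt T ! a = c"
    and t: "0 < t" "t \<le> ext_len a" "t \<le> Suc l" "t \<le> Suc (lce T (sa T ! a) p)"
  shows "t \<le> mlen k T (c # Z)" "located (c # Z) t (ext_pos a) (sa T ! ext_pos a)"
proof -
  let ?d = "cyc_pred n (sa T ! a)"
  have el: "ext_len a \<le> length (drop ?d T)" unfolding ext_len_def by (rule mlen_le_length)
  have eq: "take t (drop ?d T) = take t (c # Z)"
  proof (cases "sa T ! a = 0")
    \<comment> \<open>After the wrap-around the suffix at \<open>?d\<close> is the last symbol
      alone, so only \<open>t = 1\<close> is possible.\<close>
    case True
    then have "t = 1" using t el a cyc_pred_eq[of 0 n] n_pos by simp
    then show ?thesis using bwt_nth[OF a(1)] a cyc_pred_less[of "sa T ! a"]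
      by (simp add: take_Suc hd_drop_conv_nth)
  next
    case False
    obtain t' where t': "t = Suc t'" using t by (cases t) auto
    have "take t' (drop (sa T ! a) T) = take t' (drop p T)"
      using t t' by (intro take_drop_eq_of_le_lce) simp
    also have "take t' (drop p T) = take t' Z"
    proof -
      have "q \<in> sa_range T (take t' Z)" "length (take t' Z) = t'" "p = sa T ! q"
        using located_q[OF loc, of t'] t t' loc by (auto simp: located_def)
      then show ?thesis by (simp add: sa_range_def prefix_take_drop_iff)
    qed
    finally show ?thesis using False a t' drop_cyc_pred[of a] by simp
  qed
  have len: "t \<le> length (c # Z)" using t loc by (simp add: located_def)
  have "k \<le> occ (take t (drop ?d T)) T"
    using t(1,2) unfolding ext_len_def le_mlen_iff by simp
  then show "t \<le> mlen k T (c # Z)" using len eq by (simp add: le_mlen_iff)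
  \<comment> \<open>The stored window belongs to all \<open>ext_len a\<close> symbols; their range
    is contained in the range of the first \<open>t\<close> symbols.\<close>
  let ?X = "take (ext_len a) (drop ?d T)"
  have X: "?X \<noteq> []" "prefix (take t (drop ?d T)) ?X" "k \<le> occ ?X T"
  proof -
    show "?X \<noteq> []" using t cyc_pred_less[of "sa T ! a"] by simp
    show "prefix (take t (drop ?d T)) ?X" using t(2) by (metis min.absorb1 take_is_prefix take_take)
    show "k \<le> occ ?X T" using le_mlen_iff[of "ext_len a" k T "drop ?d T"] t by (simp add: ext_len_def)
  qed
  have w: "{ext_pos a..<ext_pos a + k} \<subseteq> sa_range T ?X"
    using X t k_pos by (intro sa_range_window) (auto simp: ext_pos_def)
  have sub: "sa_range T ?X \<subseteq> sa_range T (take t (c # Z))"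
    using sa_range_antimono[OF X(2)] eq by simp
  have "ext_pos a \<in> sa_range T ?X" "ext_pos a + k - 1 \<in> sa_range T ?X"
    using w k_pos by auto
  then have "ext_pos a < n" "ext_pos a + k \<le> n" using k_pos by (auto simp: sa_range_def)
  then show "located (c # Z) t (ext_pos a) (sa T ! ext_pos a)"
    using len w sub unfolding located_def by (intro conjI impI) auto
qed

text \<open>Row \<open>a\<close> is preceded by \<open>c\<close> and starts with the extendable
  prefix, so both upper bounds on a candidate leave room for that prefix extended by
  \<open>c\<close>.\<close>

lemma candidate_complete:
  assumes loc: "located Z l q p" and a: "bwt T ! a = c" "a \<in> sa_range T (take L Z)"
    and L: "Suc L \<le> mlen k T (c # Z)" "L \<le> l"
  shows "Suc L \<le> ext_len a" "Suc L \<le> Suc (lce T (sa T ! a) p)"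
proof -
  have an: "a < n" using a by (simp add: sa_range_def)
  have Ll: "L \<le> length Z" using L loc by (simp add: located_def)
  have occ: "k \<le> occ (c # take L Z) T" using L(1) by (simp add: le_mlen_iff)
  \<comment> \<open>If row \<open>a\<close> wrapped around, \<open>c\<close> would be the
    end-of-string symbol, which cannot be followed by a nonempty string inside the text.\<close>
  have "sa T ! a \<noteq> 0 \<or> take L Z = []"
  proof (rule ccontr)
    assume "\<not> (sa T ! a \<noteq> 0 \<or> take L Z = [])"
    then have z: "sa T ! a = 0" "take L Z \<noteq> []" by auto
    have "card (sa_range T (c # take L Z)) > 0" using occ k_pos by (simp add: occ_eq_card)
    then obtain x where "x \<in> sa_range T (c # take L Z)" by (auto simp: card_gt_0_iff)
    then have x: "x < n" "prefix (c # take L Z) (drop (sa T ! x) T)" by (auto simp: sa_range_def)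
    have "T ! (sa T ! x) = c"
      using x sa_less_length[of x T] by (metis Cons_nth_drop_Suc Cons_prefix_Cons)
    moreover have "length (c # take L Z) \<le> length (drop (sa T ! x) T)"
      using x(2) prefix_length_le by blast
    then have "sa T ! x < n - 1" using z(2) by (cases "take L Z") auto
    ultimately show False
      using last_least[of "sa T ! x"] bwt_nth[OF an] a z cyc_pred_eq[of 0 n] n_pos by simp
  qed
  then have pre: "prefix (c # take L Z) (drop (cyc_pred n (sa T ! a)) T)"
    using cyc_pred_prefix an a by blast
  then have "take (Suc L) (drop (cyc_pred n (sa T ! a)) T) = c # take L Z"
    "Suc L \<le> length (drop (cyc_pred n (sa T ! a)) T)"
    using Ll by (simp_all add: prefix_take_drop_iff)
  then show "Suc L \<le> ext_len a" using occ by (simp add: ext_len_def le_mlen_iff)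
  have "length (take L Z) \<le> lce T (sa T ! a) (sa T ! q)"
    using a located_q[OF loc L(2)] by (intro prefix_le_lce) (simp_all add: sa_range_def)
  then show "Suc L \<le> Suc (lce T (sa T ! a) p)" using loc Ll by (simp add: located_def)
qed

text \<open>Dropping the first symbol maps the occurrences of \<open>c # X\<close> injectively to
  occurrences of \<open>X\<close>.\<close>

lemma mlen_Cons_le: "mlen k T (c # Z) \<le> Suc (mlen k T Z)"
proof (rule ccontr)
  assume "\<not> ?thesis"
  then have "Suc (Suc (mlen k T Z)) \<le> mlen k T (c # Z)" by simp
  then have "Suc (mlen k T Z) \<le> length Z" "k \<le> occ (c # take (Suc (mlen k T Z)) Z) T"
    by (simp_all add: le_mlen_iff)
  moreover have "occ (c # X) T \<le> occ X T" for X
  proof -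
    have "Suc ` {p. p + length (c # X) \<le> n \<and> take (length (c # X)) (drop p T) = c # X}
        \<subseteq> {p. p + length X \<le> n \<and> take (length X) (drop p T) = X}"
    proof (intro subsetI, elim imageE CollectE conjE)
      fix x p assume p: "x = Suc p" "p + length (c # X) \<le> n" "take (length (c # X)) (drop p T) = c # X"
      then have "drop p T = T ! p # drop (Suc p) T" by (simp add: Cons_nth_drop_Suc)
      then show "x \<in> {p. p + length X \<le> n \<and> take (length X) (drop p T) = X}" using p by simp
    qed
    from card_mono[OF finite_occ this] show ?thesis
      unfolding occ_def by (simp add: card_image)
  qed
  ultimately have "Suc (mlen k T Z) \<le> mlen k T Z" by (simp add: le_mlen_iff le_trans)
  then show False by simp
qed

text \<open>The strict inclusion of the window in its run makes the run at least two positions long, which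
  excludes the end-of-string symbol and thereby the wrap-around of \<open>lf\<close>.\<close>

lemma lf_step:
  assumes loc: "located Z l q p" and j: "j < r" "head j \<le> q" "q + k \<le> tail j"
    and c: "run_symbol j = c"
  shows "Suc l \<le> mlen k T (c # Z)" "located (c # Z) (Suc l) (lf T (head j) + (q - head j)) (p - 1)"
    "0 < p"
proof -
  have tn: "tail j < n" using tail_less j by simp
  let ?q = "lf T (head j) + (q - head j)"
  have b: "bwt T ! x = c" if "q \<le> x" "x \<le> tail j" for x
    using run_constant[of j x] that j c run_symbol_eq[of j] by simp
  have nz: "sa T ! x \<noteq> 0" if "q \<le> x" "x \<le> tail j" for x
  proof
    assume z: "sa T ! x = 0"
    have "q = x" "tail j = x"
      using bwt_wrap[OF _ z, of q] bwt_wrap[OF _ z, of "tail j"] b that tn by auto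
    then show False using j k_pos by simp
  qed
  have lf: "lf T x = ?q + (x - q)" if "q \<le> x" "x \<le> tail j" for x
    using lf_in_run[of j x] that j by simp
  \<comment> \<open>Each row of the new window is the \<open>lf\<close> image of the row at the same
    offset in the old one.\<close>
  have w: "{?q..<?q + k} \<subseteq> sa_range T (c # take l Z)"
  proof
    fix y assume y: "y \<in> {?q..<?q + k}"
    let ?x = "q + (y - ?q)"
    have x: "q \<le> ?x" "?x < q + k" "?x \<le> tail j" "?x < n" using y j tn by auto
    have y_eq: "y = lf T ?x" using lf[of ?x] x y by auto
    have "prefix (c # take l Z) (drop (cyc_pred n (sa T ! ?x)) T)"
      using x b[of ?x] nz[of ?x] located_prefix[OF loc, of l ?x] by (intro cyc_pred_prefix) auto
    then show "y \<in> sa_range T (c # take l Z)"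
      using lf_props[of ?x] y_eq by (simp add: sa_range_def)
  qed
  then have "k \<le> occ (c # take l Z) T" by (intro occ_ge_window) auto
  then show m: "Suc l \<le> mlen k T (c # Z)" using loc by (simp add: le_mlen_iff located_def)
  have "?q + k \<le> n"
  proof -
    have "?q + k - 1 \<in> {?q..<?q + k}" using k_pos by auto
    then have "?q + k - 1 < n" using w by (auto simp: sa_range_def)
    then show ?thesis by simp
  qed
  moreover have "p - 1 = sa T ! ?q"
    using lf[of q] lf_props[of q] nz[of q] loc j cyc_pred_eq[of "sa T ! q" n]
    by (auto simp: located_def)
  ultimately show "located (c # Z) (Suc l) ?q (p - 1)"
    using w loc k_pos by (auto simp: located_def)
  show "0 < p" using nz[of q] loc j by (simp add: located_def)
qed

text \<open>The range of the longest extendable prefix contains both \<open>q\<close> and some position with symbol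
  \<open>c\<close>; being convex, it contains the boundary of a \<open>c\<close>-run lying between them.\<close>

lemma some_candidate_complete:
  assumes loc: "located Z (mlen k T Z) q p" and j: "j < r" "head j \<le> q" "q \<le> tail j"
    and pos: "0 < mlen k T (c # Z)"
    and nxt: "nxt = select c (rank c j)" and prv: "prv = select c (rank c j - 1)"
    and ns: "\<not> (nxt = j \<and> q + k \<le> tail j)"
  shows "\<exists>a. (nxt < r \<and> (a = head nxt \<or> a = tail nxt) \<or> 0 < rank c j \<and> prv < r \<and> a = tail prv) \<and>
     mlen k T (c # Z) \<le> ext_len a \<and> mlen k T (c # Z) \<le> Suc (lce T (sa T ! a) p)"
proof -
  let ?l = "mlen k T Z"
  obtain L where L: "Suc L = mlen k T (c # Z)" using pos by (cases "mlen k T (c # Z)") auto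
  then have Ll: "L \<le> ?l" using mlen_Cons_le[of c Z] by simp
  have kn: "k \<le> n" using mlen_zero_if_gt[of T k "c # Z"] pos by linarith
  have Lz: "L \<le> length Z" using Ll mlen_le_length[of k T Z] by simp
  let ?I = "sa_range T (take L Z)"
  have fin: ?thesis if "a \<in> ?I" "bwt T ! a = c"
    "nxt < r \<and> (a = head nxt \<or> a = tail nxt) \<or> 0 < rank c j \<and> prv < r \<and> a = tail prv" for a
    using candidate_complete[OF loc that(2,1) _ Ll] L that(3) by auto
  have qI: "q \<in> ?I" using located_q[OF loc Ll] .
  have "Suc L \<le> mlen k T (c # Z)" using L by simp
  then have "k \<le> occ (c # take L Z) T" by (simp add: le_mlen_iff)
  then have "card (sa_range T (c # take L Z)) > 0" using k_pos by (simp add: occ_eq_card)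
  then obtain y where "y \<in> sa_range T (c # take L Z)" by (auto simp: card_gt_0_iff)
  then have y: "y < n" "prefix (c # take L Z) (drop (sa T ! y) T)" by (auto simp: sa_range_def)
  let ?p = "sa T ! y"
  have yn: "?p < n" using y by simp
  then have dp: "drop ?p T = T ! ?p # drop (Suc ?p) T" by (simp add: Cons_nth_drop_Suc)
  then have py: "T ! ?p = c" "prefix (take L Z) (drop (Suc ?p) T)" using y(2) by auto
  \<comment> \<open>The position whose cyclic predecessor is the occurrence of \<open>c\<close>. It
    wraps to 0 only if nothing follows that \<open>c\<close>, and then \<open>take L Z\<close> is
    empty.\<close>
  let ?s = "if Suc ?p < n then Suc ?p else 0"
  have s: "cyc_pred n ?s = ?p" "?s < n" using yn n_pos by (auto simp: cyc_pred_eq)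
  then obtain x where x: "x < n" "sa T ! x = ?s" using sa_surj by blast
  have xb: "bwt T ! x = c" using bwt_nth[OF x(1)] x s py by simp
  have xI: "x \<in> ?I"
    using x py by (cases "Suc ?p < n") (auto simp: sa_range_def)
  obtain i where i: "i < r" "head i \<le> x" "x \<le> tail i" using run_containing[OF x(1)] .
  have ic: "run_symbol i = c" using run_constant[OF i] xb run_symbol_eq i by simp
  show ?thesis
  proof (cases "j \<le> i")
    case True
    then have nx: "j \<le> nxt" "nxt \<le> i" using select_rank[of j i c] i ic nxt by auto
    then have nr: "nxt < r" "run_symbol nxt = c" using select_symbol[of c "rank c j"] nxt i by auto
    show ?thesis
    proof (cases "nxt = j")
      case True
      \<comment> \<open>The window does not end before the tail of its run, so that tail is itself a
        row of the window.\<close>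
      then have "tail j < q + k" using ns by simp
      then have "tail j \<in> ?I" using located_prefix[OF loc Ll, of "tail j"] j tail_less by simp
      then show ?thesis using fin[of "tail j"] True nr run_symbol_tail by simp
    next
      case False
      then have "q \<le> head nxt" using tail_less_head[of j nxt] nx nr j by simp
      moreover have "head nxt \<le> x" using nx i head_mono[of nxt i] by (cases "nxt = i") simp_all
      ultimately have "head nxt \<in> ?I" using sa_range_convex[OF qI xI] by simp
      then show ?thesis using fin[of "head nxt"] nr run_symbol_eq by simp
    qed
  next
    case False
    then have pr: "0 < rank c j" "i \<le> prv" "prv < j"
      using select_rank_pred[of i j c] j ic prv by auto
    then have r: "prv < r" "run_symbol prv = c" using select_symbol[of c "rank c j - 1"] prv j by auto
    have "tail prv \<le> q" using tail_less_head[of prv j] pr j by simp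
    moreover have "x \<le> tail prv"
      using pr i r tail_less_head[of i prv] head_le_tail[of prv] by (cases "prv = i") auto
    ultimately have "tail prv \<in> ?I" using sa_range_convex[OF xI qI] by simp
    then show ?thesis using fin[of "tail prv"] r pr run_symbol_tail by simp
  qed
qed

end

section \<open>The program\<close>

text \<open>All of a step except the binary search loop itself has this form, so its effect can be
  computed by simplification with \<open>eval\<close> instead of by derivations in
  \<open>exec\<close>.\<close>

fun straight :: "prog \<Rightarrow> bool" where
  "straight (Load x y) = False"
| "straight (Store x y) = False"
| "straight (WhileNZ x c) = False"
| "straight (Seq c1 c2) \<longleftrightarrow> straight c1 \<and> straight c2"
| "straight (IfNZ x c1 c2) \<longleftrightarrow> straight c1 \<and> straight c2"
| "straight _ = True"

fun eval :: "machine \<Rightarrow> prog \<Rightarrow> (reg \<Rightarrow> nat) \<Rightarrow> reg \<Rightarrow> nat" where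
  "eval M (Const x v) f = f(x := v mod 2 ^ word_length M)"
| "eval M (Op h x y z) f = f(x := apply_op (word_length M) h (f y) (f z) mod 2 ^ word_length M)"
| "eval M (Fetch R x y) f = f(x := lookup (index M R) (f y) mod 2 ^ word_length M)"
| "eval M (Query Q x y z) f = f(x := answer M Q (f y) (f z) mod 2 ^ word_length M)"
| "eval M (Seq c1 c2) f = eval M c2 (eval M c1 f)"
| "eval M (IfNZ x c1 c2) f = (if f x \<noteq> 0 then eval M c1 f else eval M c2 f)"
| "eval M _ f = f"

fun cost :: "nat \<Rightarrow> prog \<Rightarrow> nat" where
  "cost U (Query Q x y z) = 1 + U"
| "cost U (Seq c1 c2) = cost U c1 + cost U c2"
| "cost U (IfNZ x c1 c2) = 1 + max (cost U c1) (cost U c2)"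
| "cost U _ = 1"

lemma exec_straight:
  assumes "straight c" "\<And>Q a b. query_time M Q a b \<le> U"
  shows "\<exists>t \<le> cost U c. exec M c s t (s\<lparr>regs := eval M c (regs s)\<rparr>)"
  using assms(1)
proof (induction c arbitrary: s)
  case (Const x v)
  show ?case using exec.Const[of M x v s]
    by (intro exI[of _ 1]) (simp add: set_reg_def fun_upd_def)
next
  case (Op h x y z)
  show ?case using exec.Op[of M h x y z s]
    by (intro exI[of _ 1]) (simp add: set_reg_def fun_upd_def)
next
  case (Fetch R x y)
  show ?case using exec.Fetch[of M R x y s]
    by (intro exI[of _ 1]) (simp add: set_reg_def fun_upd_def)
next
  case (Query Q x y z)
  show ?case using exec.Query[of M Q x y z s] assms(2)[of Q "regs s y" "regs s z"]
    by (intro exI[of _ "1 + query_time M Q (regs s y) (regs s z)"]) (simp add: set_reg_def fun_upd_def)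
next
  case (Seq c1 c2)
  let ?s = "s\<lparr>regs := eval M c1 (regs s)\<rparr>"
  obtain t1 where t1: "t1 \<le> cost U c1" "exec M c1 s t1 ?s" using Seq by auto
  obtain t2 where t2: "t2 \<le> cost U c2" "exec M c2 ?s t2 (?s\<lparr>regs := eval M c2 (regs ?s)\<rparr>)"
    using Seq.IH(2)[of ?s] Seq.prems by auto
  from exec.Seq[OF t1(2) t2(2)] t1(1) t2(1) show ?case
    by (intro exI[of _ "t1 + t2"]) simp
next
  case (IfNZ x c1 c2)
  show ?case
  proof (cases "regs s x = 0")
    case True
    obtain t where t: "t \<le> cost U c2" "exec M c2 s t (s\<lparr>regs := eval M c2 (regs s)\<rparr>)"
      using IfNZ by auto
    from exec.If_zero[OF True t(2)] t(1) True show ?thesis by (intro exI[of _ "1 + t"]) auto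
  next
    case False
    obtain t where t: "t \<le> cost U c1" "exec M c1 s t (s\<lparr>regs := eval M c1 (regs s)\<rparr>)"
      using IfNZ by auto
    from exec.If_nonzero[OF False t(2)] t(1) False show ?thesis by (intro exI[of _ "1 + t"]) auto
  qed
qed auto

fun written :: "prog \<Rightarrow> reg set" where
  "written (Const x v) = {x}"
| "written (Op h x y z) = {x}"
| "written (Fetch R x y) = {x}"
| "written (Query Q x y z) = {x}"
| "written (Seq c1 c2) = written c1 \<union> written c2"
| "written (IfNZ x c1 c2) = written c1 \<union> written c2"
| "written _ = {}"

lemma eval_not_written: "y \<notin> written c \<Longrightarrow> eval M c f y = f y"
  by (induction c arbitrary: f) auto

text \<open>There is no empty program; overwriting the constant register 5 stands in for it. In the
  fragments below, idle branches likewise overwrite a scratch register, and adding register 5 copies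
  a value.\<close>

fun block :: "prog list \<Rightarrow> prog" where
  "block [] = Const 5 0"
| "block [c] = c"
| "block (c # cs) = Seq c (block cs)"

text \<open>Register 0 contains the symbol \<open>c\<close>; registers 2, 3, 4 contain \<open>l\<close>, \<open>q\<close>, \<open>p\<close> of the invariant.
  Registers 5, 6, 7 contain the constants 0, 1, 9; registers 20, 21, 22 the best
  values found so far for the new \<open>l\<close>, \<open>q\<close>, \<open>p\<close>. Missing neighbours need no case distinction: if the
  rank is 0, then rank minus 1 wraps around and \<open>Select\<close> returns \<open>r\<close>; and for run \<open>r\<close> the added
  array is read beyond its end, which gives the useless candidate length 0.\<close>

definition prologue :: prog where
  "prologue = block
    [IfNZ 2 (Const 5 0) (Seq (Const 3 0) (Fetch Head_SA 4 3)),
     Const 5 0, Const 6 1, Const 7 9,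
     Const 8 7, Fetch Added 8 8,
     Const 9 8, Fetch Added 9 9,
     Const 10 0, Op Add 11 8 5, Op Less 12 6 11]"

text \<open>One round of binary search for the run containing row \<open>q\<close>: register 10 is
  the lower bound, register 11 the excluded upper bound, and register 12 the loop condition.\<close>

definition search_body :: prog where
  "search_body = block
    [Op Add 13 10 11, Const 14 2, Op Div 13 13 14,
     Fetch Head 14 13, Op Less 14 3 14,
     IfNZ 14 (Op Add 11 13 5) (Op Add 10 13 5),
     Op Sub 14 11 10, Op Less 12 6 14]"

definition neighbours :: prog where
  "neighbours = block
    [Query Rank 15 0 10, Query Select 16 0 15,
     Op Sub 17 15 6, Query Select 17 0 17, Const 20 0]"

definition common_length :: "region \<Rightarrow> reg \<Rightarrow> prog" where
  "common_length R x = block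
    [Fetch R 23 x, Query LCE 23 23 4, Op Less 24 23 2,
     IfNZ 24 (Const 24 0) (Op Add 23 2 5), Op Add 23 23 6]"

text \<open>The records of the added array have 9 words and \<open>off\<close> selects the boundary.
  Register 24 keeps the address, since the two words after the length describe the window.\<close>

definition new_length :: "nat \<Rightarrow> reg \<Rightarrow> prog" where
  "new_length off x = block
    [Op Mul 24 7 x, Const 25 off, Op Add 24 24 25, Fetch Added 25 24,
     Op Less 26 25 23, IfNZ 26 (Op Add 23 25 5) (Const 26 0)]"

definition update :: prog where
  "update = block
    [Op Less 26 20 23,
     IfNZ 26
       (block [Op Add 20 23 5, Op Add 24 24 6, Fetch Added 21 24, Op Add 24 24 6, Fetch Added 22 24])
       (Const 26 0)]"

definition attempt :: "region \<Rightarrow> nat \<Rightarrow> reg \<Rightarrow> prog" where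
  "attempt R off x = block [common_length R x, new_length off x, update]"

text \<open>Coming after the attempts, this may overwrite their result: it only applies when the
  length grows by 1, the most that is possible.\<close>

definition run_step :: prog where
  "run_step = block
    [Op Equal 18 16 10, Fetch Tail 23 10, Op Add 24 3 9, Op Less 23 23 24,
     IfNZ 18
       (IfNZ 23 (Const 23 0)
         (block [Op Add 20 2 6, Op Mul 24 10 7, Fetch Added 21 24, Fetch Head 24 10,
            Op Sub 24 3 24, Op Add 21 21 24, Op Sub 22 4 6]))
       (Const 23 0)]"

definition epilogue :: prog where
  "epilogue = block
    [Op Less 24 2 20, IfNZ 24 (Const 1 0) (Op Add 1 2 5),
     Op Add 2 20 5, Op Add 3 21 5, Op Add 4 22 5]"

definition step_tail :: prog where
  "step_tail = block
    [neighbours, attempt Head_SA 4 16, attempt Tail_SA 1 16, attempt Tail_SA 1 17,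
     run_step, epilogue]"

definition kmem_step :: prog where
  "kmem_step = Seq prologue (Seq (WhileNZ 12 search_body) step_tail)"

text \<open>At position 0 left maximality is automatic, so the current length is the answer.\<close>

definition kmem_finish :: prog where
  "kmem_finish = Seq (Const 5 0) (Op Add 1 2 5)"

section \<open>Contents of the added array\<close>

context indexed_text
begin

text \<open>The last two columns repeat global constants in every record. A \<open>k\<close> beyond
  \<open>n\<close> might not fit into a word, but it acts like \<open>Suc n\<close>, hence the
  minimum.\<close>

definition field :: "nat \<Rightarrow> nat \<Rightarrow> nat" where
  "field t j =
    [lf T (head j),
     ext_len (tail j), ext_pos (tail j), sa T ! ext_pos (tail j),
     ext_len (head j), ext_pos (head j), sa T ! ext_pos (head j),
     r, min k (Suc n)] ! t"

definition added :: "nat list" where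
  "added = map (\<lambda>x. field (x mod 9) (x div 9)) [0..<9 * r]"

lemma length_added [simp]: "length added = 9 * r"
  by (simp add: added_def)

lemma lookup_added:
  assumes "t < 9" shows "lookup added (9 * j + t) = (if j < r then field t j else 0)"
proof -
  have "9 * j + t < 9 * r \<longleftrightarrow> j < r" using assms by linarith
  then show ?thesis using assms by (simp add: lookup_def added_def)
qed

lemma ext_pos_less: "ext_pos a < n"
proof (cases "ext_len a = 0")
  case True
  then show ?thesis using n_pos by (simp add: ext_pos_def)
next
  case False
  let ?X = "take (ext_len a) (drop (cyc_pred n (sa T ! a)) T)"
  have "k \<le> occ ?X T" using le_mlen_iff[of "ext_len a" k T "drop (cyc_pred n (sa T ! a)) T"] False
    by (simp add: ext_len_def)
  moreover have "?X \<noteq> []" using False cyc_pred_less[of "sa T ! a"] by simp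
  ultimately have "{ext_pos a..<ext_pos a + k} \<subseteq> sa_range T ?X"
    using k_pos False by (intro sa_range_window) (auto simp: ext_pos_def)
  moreover have "ext_pos a \<in> {ext_pos a..<ext_pos a + k}" using k_pos by simp
  ultimately have "ext_pos a \<in> sa_range T ?X" by blast
  then show ?thesis by (simp add: sa_range_def)
qed

lemma ext_len_le: "ext_len a \<le> n"
  unfolding ext_len_def using mlen_le_length_text k_pos by blast

lemma field_le: assumes "t < 9" shows "field t j \<le> Suc n"
proof -
  have "\<forall>x \<in> set [lf T (head j),
     ext_len (tail j), ext_pos (tail j), sa T ! ext_pos (tail j),
     ext_len (head j), ext_pos (head j), sa T ! ext_pos (head j),
     r, min k (Suc n)]. x \<le> Suc n"
    using lf_props[of "head j"] ext_pos_less[of "tail j"] ext_pos_less[of "head j"]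
      ext_len_le[of "tail j"] ext_len_le[of "head j"] r_le_n
      sa_less_length[OF ext_pos_less[of "tail j"]] sa_less_length[OF ext_pos_less[of "head j"]]
    by (simp del: sa_less_length)
  moreover have "field t j \<in> set [lf T (head j),
     ext_len (tail j), ext_pos (tail j), sa T ! ext_pos (tail j),
     ext_len (head j), ext_pos (head j), sa T ! ext_pos (head j),
     r, min k (Suc n)]"
    unfolding field_def by (rule nth_mem) (use assms in simp)
  ultimately show ?thesis by blast
qed

lemma lookup_added_le: "lookup added x \<le> Suc n"
  using field_le[of "x mod 9" "x div 9"] by (simp add: lookup_def added_def)

lemma lookup_index:
  assumes "j < r"
  shows "lookup (run_heads T) j = head j" "lookup (run_tails T) j = tail j"
    "lookup (map ((!) (sa T)) (run_heads T)) j = sa T ! head j"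
    "lookup (map ((!) (sa T)) (run_tails T)) j = sa T ! tail j"
  using assms length_run_tails by (simp_all add: lookup_def head_def tail_def num_runs_def)

lemma lookup_sa_le:
  assumes "j \<le> r" "R \<in> {Head_SA, Tail_SA}" shows "lookup (moni_index T D R) j \<le> n"
proof (cases "j < r")
  case True
  then show ?thesis using assms(2) lookup_index[OF True] head_less[OF True] tail_less[OF True]
    by (auto intro: less_imp_le)
next
  case False
  then show ?thesis using assms length_run_tails by (auto simp: lookup_def num_runs_def)
qed

lemma lce_le: "lce T a b \<le> n"
  using prefix_length_le[OF longest_common_prefix_prefix1[of "drop a T" "drop b T"]]
  by (simp add: lce_def)

end

section \<open>Register contents computed by the program\<close>

locale moni_machine = indexed_text +
  fixes w :: nat and qt :: "query \<Rightarrow> nat \<Rightarrow> nat \<Rightarrow> nat"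
  assumes w_large: "32 * length T \<le> 2 ^ w"
begin

abbreviation M :: machine where "M \<equiv> moni w T qt added"

lemma M_simps [simp]:
  "word_length M = w" "index M = moni_index T added" "answer M = moni_answer T" "query_time M = qt"
  by (simp_all add: moni_def)

lemma w_bound: "32 \<le> (2::nat) ^ w" "32 * n \<le> 2 ^ w"
  using w_large n_pos by linarith+

text \<open>Since \<open>n\<close> is positive, \<open>20 * n + 11\<close> is below
  \<open>32 * n\<close>, so storing such a value in a register does not change it.\<close>

lemma mod_w: "x \<le> 20 * n + 11 \<Longrightarrow> x mod 2 ^ w = x"
  using w_bound n_pos by (intro mod_less) linarith

lemma sub_mod_w: "b \<le> a \<Longrightarrow> a \<le> 20 * n + 11 \<Longrightarrow> (a + (2 ^ w - b)) mod 2 ^ w = a - b"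
proof -
  assume a: "b \<le> a" "a \<le> 20 * n + 11"
  then have "a < 2 ^ w" using w_bound n_pos by linarith
  then have "a + (2 ^ w - b) = (a - b) + 2 ^ w" using a by linarith
  then show ?thesis using \<open>a < 2 ^ w\<close> by (simp only: mod_add_self2) simp
qed

lemma eval_common_length:
  assumes "x < 20" "R \<in> {Head_SA, Tail_SA}" "f 5 = 0" "f 6 = 1" "f x \<le> r" "f 2 \<le> n"
  shows "eval M (common_length R x) f 23 =
    Suc (min (lce T (lookup (moni_index T added R) (f x)) (f 4)) (f 2))"
proof -
  let ?a = "lookup (moni_index T added R) (f x)"
  have "?a \<le> n" using lookup_sa_le assms by blast
  then have "?a mod 2 ^ w = ?a" by (intro mod_w) linarith
  moreover have "lce T ?a (f 4) mod 2 ^ w = lce T ?a (f 4)"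
    "Suc (lce T ?a (f 4)) mod 2 ^ w = Suc (lce T ?a (f 4))"
    using lce_le[of ?a "f 4"] by (intro mod_w; linarith)+
  moreover have "f 2 mod 2 ^ w = f 2" "Suc (f 2) mod 2 ^ w = Suc (f 2)"
    "1 mod 2 ^ w = (1::nat)"
    using assms by (intro mod_w; linarith)+
  ultimately show ?thesis
    using assms by (simp add: common_length_def min_def)
qed

lemma eval_new_length:
  assumes "x < 20" "f 5 = 0" "f 7 = 9" "f x \<le> r" "off \<le> 6"
  shows "eval M (new_length off x) f 23 = min (lookup added (9 * f x + off)) (f 23)"
    "eval M (new_length off x) f 24 = 9 * f x + off"
proof -
  have m: "(9 * f x) mod 2 ^ w = 9 * f x" "off mod 2 ^ w = off"
    "(9 * f x + off) mod 2 ^ w = 9 * f x + off" "1 mod 2 ^ w = (1::nat)"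
    "lookup added (9 * f x + off) mod 2 ^ w = lookup added (9 * f x + off)"
    using assms r_le_n lookup_added_le[of "9 * f x + off"] by (intro mod_w; linarith)+
  show "eval M (new_length off x) f 23 = min (lookup added (9 * f x + off)) (f 23)"
    "eval M (new_length off x) f 24 = 9 * f x + off"
    using assms m by (simp_all add: new_length_def min_def)
qed

lemma eval_update:
  assumes "f 5 = 0" "f 6 = 1" "f 24 \<le> 9 * n + 6" "f 23 \<le> Suc n"
  shows "eval M update f 20 = max (f 20) (f 23)"
    "eval M update f 21 = (if f 20 < f 23 then lookup added (Suc (f 24)) else f 21)"
    "eval M update f 22 = (if f 20 < f 23 then lookup added (Suc (Suc (f 24))) else f 22)"
proof -
  have m: "Suc (f 24) mod 2 ^ w = Suc (f 24)" "Suc (Suc (f 24)) mod 2 ^ w = Suc (Suc (f 24))"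
    "f 23 mod 2 ^ w = f 23" "1 mod 2 ^ w = (1::nat)"
    "lookup added (Suc (f 24)) mod 2 ^ w = lookup added (Suc (f 24))"
    "lookup added (Suc (Suc (f 24))) mod 2 ^ w = lookup added (Suc (Suc (f 24)))"
    using assms lookup_added_le[of "Suc (f 24)"] lookup_added_le[of "Suc (Suc (f 24))"]
    by (intro mod_w; linarith)+
  show "eval M update f 20 = max (f 20) (f 23)"
    "eval M update f 21 = (if f 20 < f 23 then lookup added (Suc (f 24)) else f 21)"
    "eval M update f 22 = (if f 20 < f 23 then lookup added (Suc (Suc (f 24))) else f 22)"
    using assms m by (simp_all add: update_def max_def)
qed

lemma attempt_not_written: "y < 20 \<Longrightarrow> eval M (attempt R off x) f y = f y"
  by (rule eval_not_written)
    (auto simp: attempt_def common_length_def new_length_def update_def)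

lemma eval_attempt:
  assumes x: "x < 20" and R: "R \<in> {Head_SA, Tail_SA}"
    and f: "f 5 = 0" "f 6 = 1" "f 7 = 9" "f x \<le> r" "f 2 \<le> n" and off: "off \<le> 6"
    and t: "t = min (lookup added (9 * f x + off))
       (Suc (min (lce T (lookup (moni_index T added R) (f x)) (f 4)) (f 2)))"
  shows "eval M (attempt R off x) f 20 = max (f 20) t"
    "eval M (attempt R off x) f 21 =
      (if f 20 < t then lookup added (Suc (9 * f x + off)) else f 21)"
    "eval M (attempt R off x) f 22 =
      (if f 20 < t then lookup added (Suc (Suc (9 * f x + off))) else f 22)"
proof -
  let ?g = "eval M (common_length R x) f"
  let ?h = "eval M (new_length off x) ?g"
  have g: "?g y = f y" if "y < 23" for y
    using that by (intro eval_not_written) (auto simp: common_length_def)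
  have h: "?h y = f y" if "y < 23" for y
  proof -
    have "?h y = ?g y" using that by (intro eval_not_written) (auto simp: new_length_def)
    then show ?thesis using g[OF that] by simp
  qed
  have gx: "?g x = f x" using g x by simp
  have g23: "?g 23 = Suc (min (lce T (lookup (moni_index T added R) (f x)) (f 4)) (f 2))"
    using eval_common_length[OF x R f(1,2,4,5)] .
  have h24: "?h 24 = 9 * f x + off" and h23: "?h 23 = t"
    using eval_new_length[of x ?g off, unfolded gx g23] x f off g[of 5] g[of 7]
    unfolding t by simp_all
  have "t \<le> Suc n" unfolding t using f(5) by linarith
  moreover have "9 * f x + off \<le> 9 * n + 6" using f(4) off r_le_n by linarith
  ultimately show "eval M (attempt R off x) f 20 = max (f 20) t"
    "eval M (attempt R off x) f 21 =
      (if f 20 < t then lookup added (Suc (9 * f x + off)) else f 21)"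
    "eval M (attempt R off x) f 22 =
      (if f 20 < t then lookup added (Suc (Suc (9 * f x + off))) else f 22)"
    using eval_update[of ?h] h[of 5] h[of 6] h[of 20] h[of 21] h[of 22] f(1,2)
    unfolding attempt_def block.simps eval.simps h23 h24 by simp_all
qed

text \<open>Soundness of the candidate kept so far. Completeness is tracked separately, by lower
  bounds on register 20.\<close>

definition best :: "nat list \<Rightarrow> (reg \<Rightarrow> nat) \<Rightarrow> bool" where
  "best Z f \<longleftrightarrow> f 20 \<le> mlen k T Z \<and> (0 < f 20 \<longrightarrow> located Z (f 20) (f 21) (f 22))"

text \<open>Soundness is preserved, the best length never decreases, and the candidate of an
  existing run is taken into account.\<close>

lemma attempt_best:
  assumes x: "x < 20" and b: "R = Head_SA \<and> off = 4 \<and> b = head \<or> R = Tail_SA \<and> off = 1 \<and> b = tail"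
    and f: "f 5 = 0" "f 6 = 1" "f 7 = 9" "f x \<le> r" "f 2 = mlen k T Z"
    and loc: "located Z (f 2) (f 3) (f 4)"
    and c: "f x < r \<Longrightarrow> run_symbol (f x) = c"
    and best: "best (c # Z) f"
    and g: "g = eval M (attempt R off x) f"
  shows "best (c # Z) g" "f 20 \<le> g 20"
    "f x < r \<Longrightarrow> min (ext_len (b (f x))) (Suc (min (lce T (sa T ! b (f x)) (f 4)) (f 2))) \<le> g 20"
proof -
  define t where "t = min (lookup added (9 * f x + off))
       (Suc (min (lce T (lookup (moni_index T added R) (f x)) (f 4)) (f 2)))"
  have R: "R \<in> {Head_SA, Tail_SA}" and off: "off \<le> 6" using b by auto
  have f2: "f 2 \<le> n" using f(5) mlen_le_length_text k_pos by simp
  have ev: "g 20 = max (f 20) t"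
    "g 21 = (if f 20 < t then lookup added (Suc (9 * f x + off)) else f 21)"
    "g 22 = (if f 20 < t then lookup added (Suc (Suc (9 * f x + off))) else f 22)"
    using eval_attempt[OF x R f(1-4) f2 off t_def] unfolding g by simp_all
  show "f 20 \<le> g 20" using ev by simp
  have val: "t = min (ext_len (b (f x))) (Suc (min (lce T (sa T ! b (f x)) (f 4)) (f 2)))"
    "lookup added (Suc (9 * f x + off)) = ext_pos (b (f x))"
    "lookup added (Suc (Suc (9 * f x + off))) = sa T ! ext_pos (b (f x))"
    "b (f x) < n" "bwt T ! b (f x) = c" if j: "f x < r"
    using b lookup_added[of off "f x"] lookup_added[of "Suc off" "f x"]
      lookup_added[of "Suc (Suc off)" "f x"] j lookup_index[OF j] head_less[OF j] tail_less[OF j]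
      c[OF j] run_symbol_eq[OF j] run_symbol_tail[OF j]
    by (auto simp: field_def t_def)
  then show "min (ext_len (b (f x))) (Suc (min (lce T (sa T ! b (f x)) (f 4)) (f 2))) \<le> g 20"
    if "f x < r"
    using ev(1) that by simp
  show "best (c # Z) g"
  proof (cases "f 20 < t")
    case True
    \<comment> \<open>For a missing neighbour the length is read beyond the end of the array as 0,
      which never improves the best value.\<close>
    have j: "f x < r"
    proof (rule ccontr)
      assume "\<not> f x < r"
      then have "lookup added (9 * f x + off) = 0" using lookup_added[of off "f x"] off by simp
      then show False using True by (simp add: t_def)
    qed
    have "t \<le> mlen k T (c # Z) \<and> located (c # Z) t (ext_pos (b (f x))) (sa T ! ext_pos (b (f x)))"
      using candidate_sound[OF loc val(4,5)[OF j], of t] True val(1)[OF j] by auto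
    then show ?thesis using ev True val(2,3)[OF j] by (simp add: best_def max_absorb2)
  next
    case False
    then show ?thesis using best ev by (simp add: best_def max_absorb1)
  qed
qed

text \<open>If the rank is 0, the argument of the second \<open>Select\<close> wraps around. Any run
  it returns still has the right symbol, which is all that soundness requires.\<close>

lemma eval_neighbours:
  assumes f: "f 6 = 1" "f 10 < r"
    and g: "g = eval M neighbours f"
  shows "g 16 = select (f 0) (rank (f 0) (f 10))" "g 17 \<le> r" "g 20 = 0"
    "g 17 < r \<Longrightarrow> run_symbol (g 17) = f 0"
    "0 < rank (f 0) (f 10) \<Longrightarrow> g 17 = select (f 0) (rank (f 0) (f 10) - 1)"
    "y < 15 \<Longrightarrow> g y = f y"
proof -
  have r: "rank (f 0) (f 10) mod 2 ^ w = rank (f 0) (f 10)"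
    using rank_le[of "f 0" "f 10"] r_le_n by (intro mod_w) linarith
  have s: "select (f 0) b mod 2 ^ w = select (f 0) b" for b
    using select_le[of "f 0" b] r_le_n by (intro mod_w) linarith
  have g17: "g 17 = select (f 0) ((rank (f 0) (f 10) + (2 ^ w - 1)) mod 2 ^ w)"
    and "g 16 = select (f 0) (rank (f 0) (f 10))" "g 20 = 0"
    using f r s
    by (simp_all add: g neighbours_def del: moni_answer.simps flip: rank_def select_def)
  then show "g 16 = select (f 0) (rank (f 0) (f 10))" "g 20 = 0" by simp_all
  show "g 17 \<le> r" unfolding g17 by (rule select_le)
  show "g 17 < r \<Longrightarrow> run_symbol (g 17) = f 0" unfolding g17 by (rule select_symbol)
  show "g 17 = select (f 0) (rank (f 0) (f 10) - 1)" if "0 < rank (f 0) (f 10)"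
    unfolding g17 using that sub_mod_w[of 1 "rank (f 0) (f 10)"] rank_le[of "f 0" "f 10"] r_le_n by simp
  show "y < 15 \<Longrightarrow> g y = f y"
    unfolding g by (rule eval_not_written) (auto simp: neighbours_def)
qed

lemma eval_run_step:
  assumes f: "f 6 = 1" "f 7 = 9" "f 10 < r" "f 9 = min k (Suc n)" "f 2 \<le> n"
    and q: "head (f 10) \<le> f 3" "f 3 \<le> tail (f 10)" and p: "f 4 < n"
    and g: "g = eval M run_step f"
  shows "f 16 = f 10 \<Longrightarrow> f 3 + k \<le> tail (f 10) \<Longrightarrow> 0 < f 4 \<Longrightarrow>
      g 20 = Suc (f 2) \<and> g 21 = lf T (head (f 10)) + (f 3 - head (f 10)) \<and> g 22 = f 4 - 1"
    "\<not> (f 16 = f 10 \<and> f 3 + k \<le> tail (f 10)) \<Longrightarrow> g 20 = f 20 \<and> g 21 = f 21 \<and> g 22 = f 22"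
    "y < 18 \<Longrightarrow> g y = f y"
proof -
  have tl: "tail (f 10) < n" "head (f 10) < n" using tail_less head_less f by simp_all
  have lfn: "lf T (head (f 10)) < n" using lf_props by simp
  have m: "tail (f 10) mod 2 ^ w = tail (f 10)" "head (f 10) mod 2 ^ w = head (f 10)"
    "1 mod 2 ^ w = (1::nat)" "lf T (head (f 10)) mod 2 ^ w = lf T (head (f 10))"
    "(lf T (head (f 10)) + (f 3 - head (f 10))) mod 2 ^ w = lf T (head (f 10)) + (f 3 - head (f 10))"
    "(f 3 + f 9) mod 2 ^ w = f 3 + f 9" "(9 * f 10) mod 2 ^ w = 9 * f 10"
    "Suc (f 2) mod 2 ^ w = Suc (f 2)"
    using tl lfn f q r_le_n by (intro mod_w; linarith)+
  have s: "(f 3 + (2 ^ w - head (f 10))) mod 2 ^ w = f 3 - head (f 10)"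
    using q tl by (intro sub_mod_w) simp_all
  have s1: "(f 4 + (2 ^ w - 1)) mod 2 ^ w = f 4 - 1" if "0 < f 4"
    using p that by (intro sub_mod_w) simp_all
  have L: "lookup added (9 * f 10) = lf T (head (f 10))"
    using lookup_added[of 0 "f 10"] f by (simp add: field_def)
  \<comment> \<open>Tails are below \<open>n\<close>, so for \<open>k > n\<close> both sides hold
    and truncating \<open>k\<close> does not affect the test.\<close>
  have cond: "tail (f 10) < f 3 + f 9 \<longleftrightarrow> \<not> f 3 + k \<le> tail (f 10)"
    using f(4) tl by (auto simp: min_def)
  show "g 20 = Suc (f 2) \<and> g 21 = lf T (head (f 10)) + (f 3 - head (f 10)) \<and> g 22 = f 4 - 1"
    if "f 16 = f 10" "f 3 + k \<le> tail (f 10)" "0 < f 4"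
    using f(1,2) that cond m s s1[OF that(3)] L lookup_index[OF f(3)]
    by (simp add: g run_step_def mult.commute[of _ 9])
  show "g 20 = f 20 \<and> g 21 = f 21 \<and> g 22 = f 22"
    if "\<not> (f 16 = f 10 \<and> f 3 + k \<le> tail (f 10))"
  proof (cases "f 16 = f 10")
    case True
    then have "tail (f 10) < f 3 + f 9" using that cond by simp
    then show ?thesis using True f(1,2) m lookup_index[OF f(3)] by (simp add: g run_step_def)
  next
    case False
    then show ?thesis by (simp add: g run_step_def)
  qed
  show "y < 18 \<Longrightarrow> g y = f y"
    unfolding g by (rule eval_not_written) (auto simp: run_step_def)
qed

lemma eval_epilogue:
  assumes "f 5 = 0" "f 2 \<le> n" "f 20 \<le> n" and g: "g = eval M epilogue f"
  shows "g 1 = (if f 2 < f 20 then 0 else f 2)" "g 2 = f 20"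
    "g 3 = f 21 mod 2 ^ w" "g 4 = f 22 mod 2 ^ w"
proof -
  have "f 2 mod 2 ^ w = f 2" "f 20 mod 2 ^ w = f 20" "1 mod 2 ^ w = (1::nat)"
    using assms by (intro mod_w; linarith)+
  then show "g 1 = (if f 2 < f 20 then 0 else f 2)" "g 2 = f 20"
    "g 3 = f 21 mod 2 ^ w" "g 4 = f 22 mod 2 ^ w"
    using assms by (simp_all add: epilogue_def)
qed

text \<open>At length 0 the window registers may hold stale values, or the initial zeros, and are
  therefore reset to row 0.\<close>

lemma eval_prologue:
  assumes g: "g = eval M prologue f"
  shows "g 0 = f 0" "g 2 = f 2" "g 3 = (if f 2 = 0 then 0 else f 3)"
    "g 4 = (if f 2 = 0 then sa T ! 0 else f 4)"
    "g 5 = 0" "g 6 = 1" "g 7 = 9" "g 9 = min k (Suc n)"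
    "g 10 = 0" "g 11 = r" "g 12 = of_bool (1 < r)"
proof -
  have L: "lookup added 7 = r" "lookup added 8 = min k (Suc n)"
    "lookup (map ((!) (sa T)) (run_heads T)) 0 = sa T ! 0"
    using lookup_added[of 7 0] lookup_added[of 8 0] r_pos lookup_index[of 0]
    by (simp_all add: field_def)
  have "sa T ! 0 < n" using n_pos by simp
  then have m: "r mod 2 ^ w = r" "min k (Suc n) mod 2 ^ w = min k (Suc n)"
    "1 mod 2 ^ w = (1::nat)" "7 mod 2 ^ w = (7::nat)" "8 mod 2 ^ w = (8::nat)" "9 mod 2 ^ w = (9::nat)"
    "sa T ! 0 mod 2 ^ w = sa T ! 0"
    using r_le_n by (intro mod_w; linarith)+
  show "g 0 = f 0" "g 2 = f 2"
    unfolding g by (rule eval_not_written, simp add: prologue_def)+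
  show "g 3 = (if f 2 = 0 then 0 else f 3)"
    "g 4 = (if f 2 = 0 then sa T ! 0 else f 4)"
    "g 5 = 0" "g 6 = 1" "g 7 = 9" "g 9 = min k (Suc n)"
    "g 10 = 0" "g 11 = r" "g 12 = of_bool (1 < r)"
    using m by (cases "f 2 = 0"; simp add: g prologue_def L)+
qed

lemma eval_search_body:
  assumes f: "f 5 = 0" "f 6 = 1" and lo: "f 10 < f 11" "f 11 \<le> r"
    and g: "g = eval M search_body f" and mid: "mid = (f 10 + f 11) div 2"
  shows "g 10 = (if f 3 < head mid then f 10 else mid)"
    "g 11 = (if f 3 < head mid then mid else f 11)"
    "g 12 = of_bool (1 < g 11 - g 10)"
    "y < 10 \<Longrightarrow> g y = f y"
proof -
  have midr: "f 10 \<le> mid" "mid < f 11" using lo mid by auto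
  then have j: "mid < r" using lo by simp
  have m: "(f 10 + f 11) mod 2 ^ w = f 10 + f 11" "mid mod 2 ^ w = mid"
    "f 10 mod 2 ^ w = f 10" "f 11 mod 2 ^ w = f 11" "head mid mod 2 ^ w = head mid"
    "1 mod 2 ^ w = (1::nat)" "2 mod 2 ^ w = (2::nat)"
    using lo midr r_le_n head_less[OF j] by (intro mod_w; linarith)+
  have s: "(mid + (2 ^ w - f 10)) mod 2 ^ w = mid - f 10"
    "(f 11 + (2 ^ w - mid)) mod 2 ^ w = f 11 - mid"
    using midr lo r_le_n by (intro sub_mod_w; simp)+
  note L = lookup_index(1)[OF j]
  show "g 10 = (if f 3 < head mid then f 10 else mid)"
    "g 11 = (if f 3 < head mid then mid else f 11)"
    "g 12 = of_bool (1 < g 11 - g 10)"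
    using f m s L by (cases "f 3 < head mid"; simp add: g search_body_def flip: mid)+
  show "y < 10 \<Longrightarrow> g y = f y"
    unfolding g by (rule eval_not_written) (auto simp: search_body_def)
qed

text \<open>The interval halves in every round, so \<open>d\<close> rounds suffice. A round costs 1
  for the test and 9 for the body.\<close>

lemma search_loop:
  assumes U: "\<And>Q a b. qt Q a b \<le> U"
    and "regs s 5 = 0" "regs s 6 = 1"
    and "regs s 10 < regs s 11" "regs s 11 \<le> r"
    and "head (regs s 10) \<le> regs s 3" "regs s 11 < r \<longrightarrow> regs s 3 < head (regs s 11)"
    and "regs s 12 = of_bool (1 < regs s 11 - regs s 10)"
    and "regs s 11 - regs s 10 \<le> 2 ^ d"
  shows "\<exists>t g. t \<le> 1 + d * 10 \<and> exec M (WhileNZ 12 search_body) s t (s\<lparr>regs := g\<rparr>) \<and>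
    g 10 < r \<and> head (g 10) \<le> g 3 \<and> (Suc (g 10) < r \<longrightarrow> g 3 < head (Suc (g 10))) \<and>
    (\<forall>y < 10. g y = regs s y)"
  using assms(2-)
proof (induction d arbitrary: s)
  case 0
  then have h: "regs s 11 = Suc (regs s 10)" by simp
  then have "exec M (WhileNZ 12 search_body) s 1 s" using 0 by (intro exec.While_zero) simp
  then show ?case using 0 h by (intro exI[of _ 1] exI[of _ "regs s"]) simp
next
  case (Suc d)
  let ?lo = "regs s 10" and ?hi = "regs s 11"
  show ?case
  proof (cases "1 < ?hi - ?lo")
    case False
    then have h: "?hi = Suc ?lo" using Suc.prems by simp
    then have "exec M (WhileNZ 12 search_body) s 1 s" using Suc.prems by (intro exec.While_zero) simp
    then show ?thesis using Suc.prems h by (intro exI[of _ 1] exI[of _ "regs s"]) simp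
  next
    case True
    define mid where "mid = (?lo + ?hi) div 2"
    define g where "g = eval M search_body (regs s)"
    have mid: "?lo < mid" "mid < ?hi" using True by (auto simp: mid_def)
    \<comment> \<open>The midpoint is rounded down, so the upper half may be the larger one; it
      still fits because the bound is a power of two.\<close>
    have half: "mid - ?lo \<le> 2 ^ d" "?hi - mid \<le> 2 ^ d"
      using Suc.prems(8) True unfolding mid_def power_Suc by linarith+
    note ev = eval_search_body[OF Suc.prems(1-4) g_def mid_def]
    have "straight search_body" "cost U search_body = 9" by (simp_all add: search_body_def)
    then obtain t1 where t1: "t1 \<le> 9" "exec M search_body s t1 (s\<lparr>regs := g\<rparr>)"
      using exec_straight[of search_body M U s] U by (auto simp: g_def)
    let ?s = "s\<lparr>regs := g\<rparr>"
    have "\<exists>t g'. t \<le> 1 + d * 10 \<and> exec M (WhileNZ 12 search_body) ?s t (?s\<lparr>regs := g'\<rparr>) \<and>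
      g' 10 < r \<and> head (g' 10) \<le> g' 3 \<and> (Suc (g' 10) < r \<longrightarrow> g' 3 < head (Suc (g' 10))) \<and>
      (\<forall>y < 10. g' y = regs ?s y)"
      by (rule Suc.IH) (use Suc.prems ev half mid in auto)
    then obtain t2 g' where t2: "t2 \<le> 1 + d * 10"
        "exec M (WhileNZ 12 search_body) ?s t2 (s\<lparr>regs := g'\<rparr>)"
      and g': "g' 10 < r" "head (g' 10) \<le> g' 3" "Suc (g' 10) < r \<longrightarrow> g' 3 < head (Suc (g' 10))"
        "\<forall>y < 10. g' y = g y"
      by auto
    have "regs s 12 \<noteq> 0" using Suc.prems(7) True by simp
    from exec.While_nonzero[OF this t1(2) t2(2)] show ?thesis
      using t1(1) t2(1) g' ev(4) by (intro exI[of _ "1 + t1 + t2"] exI[of _ g']) simp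
  qed
qed

text \<open>\<open>best\<close> is carried through the three attempts. Register 20 only grows there,
  so the lower bound from each attempt survives to the end, and one of them reaches the optimum
  unless the whole window shifts by \<open>lf\<close>.\<close>

lemma eval_step_tail:
  assumes c: "c = f 0" and f: "f 2 = mlen k T Z" "f 5 = 0" "f 6 = 1" "f 7 = 9" "f 9 = min k (Suc n)"
    and loc: "located Z (f 2) (f 3) (f 4)"
    and j: "f 10 < r" "head (f 10) \<le> f 3" "f 3 \<le> tail (f 10)"
    and g: "g = eval M step_tail f"
  shows "g 2 = mlen k T (c # Z)" "0 < g 2 \<longrightarrow> located (c # Z) (g 2) (g 3) (g 4)"
    "g 1 = (if mlen k T Z < mlen k T (c # Z) then 0 else mlen k T Z)"
proof -
  define f1 where "f1 = eval M neighbours f"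
  define f2 where "f2 = eval M (attempt Head_SA 4 16) f1"
  define f3 where "f3 = eval M (attempt Tail_SA 1 16) f2"
  define f4 where "f4 = eval M (attempt Tail_SA 1 17) f3"
  define f5 where "f5 = eval M run_step f4"
  have gf: "g = eval M epilogue f5"
    by (simp add: g step_tail_def f1_def f2_def f3_def f4_def f5_def)
  let ?rk = "rank c (f 10)"
  let ?nxt = "select c ?rk" and ?prv = "select c (?rk - 1)"
  note nb = eval_neighbours[OF f(3) j(1) f1_def, folded c]
  have k1: "f1 y = f y" if "y < 15" for y using nb(6) that by simp
  have k2: "f2 y = f1 y" if "y < 20" for y unfolding f2_def using attempt_not_written that by simp
  have k3: "f3 y = f1 y" if "y < 20" for y
    unfolding f3_def using attempt_not_written that k2 by simp
  have k4: "f4 y = f1 y" if "y < 20" for y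
    unfolding f4_def using attempt_not_written that k3 by simp
  have n16: "f1 16 \<le> r" "f1 16 < r \<Longrightarrow> run_symbol (f1 16) = c"
    unfolding nb(1) by (rule select_le, rule select_symbol)
  have b1: "best (c # Z) f1" using nb(3) by (simp add: best_def)
  note a2 = attempt_best[where Z = Z and c = c and f = f1 and x = 16, OF _ _ _ _ _ _ _ _ _ b1 f2_def]
  have b2: "best (c # Z) f2" and g2: "f1 16 < r \<Longrightarrow>
      min (ext_len (head (f1 16))) (Suc (min (lce T (sa T ! head (f1 16)) (f 4)) (f 2))) \<le> f2 20"
    using a2[where b = head] n16 k1 f loc by simp_all
  note a3 = attempt_best[where Z = Z and c = c and f = f2 and x = 16, OF _ _ _ _ _ _ _ _ _ b2 f3_def]
  have b3: "best (c # Z) f3" and l3: "f2 20 \<le> f3 20" and g3: "f1 16 < r \<Longrightarrow>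
      min (ext_len (tail (f1 16))) (Suc (min (lce T (sa T ! tail (f1 16)) (f 4)) (f 2))) \<le> f3 20"
    using a3[where b = tail] n16 k1 k2 f loc by simp_all
  note a4 = attempt_best[where Z = Z and c = c and f = f3 and x = 17, OF _ _ _ _ _ _ _ _ _ b3 f4_def]
  have b4: "best (c # Z) f4" and l4: "f3 20 \<le> f4 20" and g4: "f1 17 < r \<Longrightarrow>
      min (ext_len (tail (f1 17))) (Suc (min (lce T (sa T ! tail (f1 17)) (f 4)) (f 2))) \<le> f4 20"
    using a4[where b = tail] nb(2,4) k1 k3 f loc by simp_all
  have fn: "f 2 \<le> n" using f(1) mlen_le_length_text k_pos by simp
  have p: "f 4 < n" using loc by (auto simp: located_def)
  note rs = eval_run_step[of f4 f5, OF _ _ _ _ _ _ _ _ f5_def]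
  have k5: "f5 y = f y" if "y < 15" for y
    using rs(3)[of y] k4 k1 f j fn p that by simp
  have m_le: "mlen k T (c # Z) \<le> Suc (f 2)" using mlen_Cons_le f by simp
  have new: "f5 20 = mlen k T (c # Z) \<and> (0 < f5 20 \<longrightarrow> located (c # Z) (f5 20) (f5 21) (f5 22))"
  proof (cases "?nxt = f 10 \<and> f 3 + k \<le> tail (f 10)")
    case True
    then have cs: "run_symbol (f 10) = c" using n16(2) nb(1) j(1) by simp
    note ls = lf_step[OF loc j(1,2) conjunct2[OF True] cs]
    have "f5 20 = Suc (f 2) \<and> f5 21 = lf T (head (f 10)) + (f 3 - head (f 10)) \<and> f5 22 = f 4 - 1"
      using rs(1) k4 k1 f j fn p True ls(3) nb(1) by simp
    then show ?thesis using ls m_le by simp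
  next
    case False
    then have e: "f5 20 = f4 20 \<and> f5 21 = f4 21 \<and> f5 22 = f4 22"
      using rs(2) k4 k1 f j fn p nb(1) by auto
    have "mlen k T (c # Z) \<le> f4 20"
    proof (cases "0 < mlen k T (c # Z)")
      case True
      from some_candidate_complete[OF loc[unfolded f(1)] j True refl refl False]
      obtain a where a: "?nxt < r \<and> (a = head ?nxt \<or> a = tail ?nxt) \<or> 0 < ?rk \<and> ?prv < r \<and> a = tail ?prv"
        "mlen k T (c # Z) \<le> ext_len a" "mlen k T (c # Z) \<le> Suc (lce T (sa T ! a) (f 4))"
        by blast
      \<comment> \<open>The remaining bound, by the current length, holds since the length grows by
        at most 1.\<close>
      then have le: "mlen k T (c # Z) \<le> min (ext_len a) (Suc (min (lce T (sa T ! a) (f 4)) (f 2)))"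
        using m_le by simp
      from a(1) consider "?nxt < r" "a = head ?nxt" | "?nxt < r" "a = tail ?nxt"
        | "0 < ?rk" "?prv < r" "a = tail ?prv" by metis
      then show ?thesis
      proof cases
        case 1
        then show ?thesis using g2 nb(1) le l3 l4 by (metis order_trans)
      next
        case 2
        then show ?thesis using g3 nb(1) le l4 by (metis order_trans)
      next
        case 3
        then show ?thesis using g4 nb(5) le by (metis order_trans)
      qed
    qed simp
    then show ?thesis using b4 e by (auto simp: best_def)
  qed
  note f5 = conjunct1[OF new] conjunct2[OF new]
  have f5n: "f5 20 \<le> n" using f5(1) mlen_le_length_text k_pos by simp
  note ep = eval_epilogue[where f = f5 and g = g, OF _ _ f5n gf]
  show "g 2 = mlen k T (c # Z)" "g 1 = (if mlen k T Z < mlen k T (c # Z) then 0 else mlen k T Z)"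
    using ep k5 f fn f5 by simp_all
  show "0 < g 2 \<longrightarrow> located (c # Z) (g 2) (g 3) (g 4)"
  proof
    assume "0 < g 2"
    then have l: "located (c # Z) (f5 20) (f5 21) (f5 22)" using f5(2) ep(2) k5 f fn by simp
    then have "f5 21 < n" "f5 22 < n" by (auto simp: located_def)
    then have "f5 21 mod 2 ^ w = f5 21" "f5 22 mod 2 ^ w = f5 22"
      by (intro mod_w; linarith)+
    then show "located (c # Z) (g 2) (g 3) (g 4)" using l ep k5 f fn by simp
  qed
qed

section \<open>Processing a pattern\<close>

text \<open>Making no claim on the window at length 0 lets the all-zero initial state
  qualify.\<close>

definition tracks :: "nat list \<Rightarrow> state \<Rightarrow> bool" where
  "tracks Z s \<longleftrightarrow> regs s 2 = mlen k T Z \<and>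
     (0 < regs s 2 \<longrightarrow> located Z (regs s 2) (regs s 3) (regs s 4))"

lemma straight_step_tail: "straight step_tail"
  by (simp add: step_tail_def neighbours_def attempt_def common_length_def new_length_def
      update_def run_step_def epilogue_def)

text \<open>The six queries are one \<open>Rank\<close>, two \<open>Select\<close>, and one
  \<open>LCE\<close> for each of the three attempts.\<close>

lemma cost_step_tail: "cost U step_tail \<le> 87 + 6 * U"
proof -
  have "cost U neighbours = 5 + 3 * U" "cost U run_step \<le> 13" "cost U epilogue \<le> 6"
    "cost U update \<le> 8"
    by (simp_all add: neighbours_def run_step_def epilogue_def update_def)
  moreover have "cost U (common_length R x) = 6 + U" "cost U (new_length off x) = 7" for R x off
    by (simp_all add: common_length_def new_length_def)
  ultimately show ?thesis by (simp add: step_tail_def attempt_def)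
qed

lemma exec_kmem_step:
  assumes U: "\<And>Q a b. qt Q a b \<le> U" and d: "r \<le> 2 ^ d"
    and tr: "tracks Z s" and c: "c < 2 ^ w"
  shows "\<exists>t s'. exec M kmem_step (set_reg M 0 c s) t s' \<and> t \<le> 110 + 6 * U + 10 * d \<and>
    tracks (c # Z) s' \<and>
    regs s' 1 = (if mlen k T Z < mlen k T (c # Z) then 0 else mlen k T Z)"
proof -
  let ?s = "set_reg M 0 c s"
  have s: "regs ?s 0 = c" "regs ?s y = regs s y" if "y > 0" for y
    using c that by (simp_all add: set_reg_def)
  define f where "f = eval M prologue (regs ?s)"
  let ?s1 = "?s\<lparr>regs := f\<rparr>"
  have "straight prologue" "cost U prologue \<le> 20" by (simp_all add: prologue_def)
  then obtain t1 where t1: "t1 \<le> 20" "exec M prologue ?s t1 ?s1"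
    using exec_straight[of prologue M U ?s] U unfolding f_def by (auto intro: le_trans)
  note ev = eval_prologue[OF f_def]
  have f0: "f 0 = c" using ev(1) s(1)[of 1] by simp
  have f2: "f 2 = mlen k T Z" using ev(2) s(2)[of 2] tr by (simp add: tracks_def)
  have loc: "located Z (f 2) (f 3) (f 4)"
    using located_0[of Z] tr s(2)[of 2] s(2)[of 3] s(2)[of 4] ev(2,3,4)
    by (cases "f 2 = 0") (auto simp: tracks_def)
  have "\<exists>t g. t \<le> 1 + d * 10 \<and> exec M (WhileNZ 12 search_body) ?s1 t (?s1\<lparr>regs := g\<rparr>) \<and>
    g 10 < r \<and> head (g 10) \<le> g 3 \<and> (Suc (g 10) < r \<longrightarrow> g 3 < head (Suc (g 10))) \<and>
    (\<forall>y < 10. g y = regs ?s1 y)"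
  proof (rule search_loop[OF U])
    show "regs ?s1 5 = 0" "regs ?s1 6 = 1" "regs ?s1 10 < regs ?s1 11" "regs ?s1 11 \<le> r"
      using ev(5,6,9,10) r_pos by simp_all
    show "regs ?s1 12 = of_bool (1 < regs ?s1 11 - regs ?s1 10)"
      "regs ?s1 11 - regs ?s1 10 \<le> 2 ^ d" "regs ?s1 11 < r \<longrightarrow> regs ?s1 3 < head (regs ?s1 11)"
      using ev(9,10,11) d by simp_all
    show "head (regs ?s1 10) \<le> regs ?s1 3"
      using ev(9) by simp
  qed
  then obtain t2 g where loop: "t2 \<le> 1 + d * 10"
      "exec M (WhileNZ 12 search_body) ?s1 t2 (?s1\<lparr>regs := g\<rparr>)"
    and g: "g 10 < r" "head (g 10) \<le> g 3" "Suc (g 10) < r \<longrightarrow> g 3 < head (Suc (g 10))"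
      and gf': "\<forall>y < 10. g y = regs ?s1 y"
    by blast
  have t2: "exec M (WhileNZ 12 search_body) ?s1 t2 (?s\<lparr>regs := g\<rparr>)"
    using loop(2) by simp
  have gf: "g y = f y" if "y < 10" for y
    using gf' that by simp
  let ?s2 = "?s\<lparr>regs := g\<rparr>"
  have "g 3 < n" using loc gf[of 3] by (simp add: located_def)
  then have g3: "g 3 \<le> tail (g 10)"
  proof (cases "Suc (g 10) < r")
    case True
    then show ?thesis using g(3) head_Suc_eq by simp
  next
    case False
    then show ?thesis using tail_eq[OF g(1)] \<open>g 3 < n\<close> by simp
  qed
  define h where "h = eval M step_tail g"
  have "\<exists>t \<le> cost U step_tail. exec M step_tail ?s2 t (?s2\<lparr>regs := eval M step_tail (regs ?s2)\<rparr>)"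
    by (rule exec_straight[OF straight_step_tail]) (simp add: U)
  then obtain t3 where t3: "t3 \<le> 87 + 6 * U" "exec M step_tail ?s2 t3 (?s\<lparr>regs := h\<rparr>)"
    using cost_step_tail[of U] unfolding h_def by (auto intro: le_trans)
  have pre: "c = g 0" "g 2 = mlen k T Z" "g 5 = 0" "g 6 = 1" "g 7 = 9" "g 9 = min k (Suc n)"
    "located Z (g 2) (g 3) (g 4)"
    using gf[of 0] gf[of 2] gf[of 3] gf[of 4] gf[of 5] gf[of 6] gf[of 7] gf[of 9] f0 f2 loc ev(5-8)
    by simp_all
  note eval_step_tail[OF pre g(1,2) g3 h_def]
  moreover have "exec M kmem_step ?s (t1 + (t2 + t3)) (?s\<lparr>regs := h\<rparr>)"
    unfolding kmem_step_def by (rule exec.Seq[OF t1(2) exec.Seq[OF t2 t3(2)]])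
  moreover have "t1 + (t2 + t3) \<le> 110 + 6 * U + 10 * d" using t1(1) loop(1) t3(1) by linarith
  ultimately show ?thesis
    by (intro exI[of _ "t1 + (t2 + t3)"] exI[of _ "?s\<lparr>regs := h\<rparr>"]) (simp add: tracks_def)
qed

lemma exec_kmem_finish:
  assumes "regs s 2 \<le> n"
  shows "\<exists>s'. exec M kmem_finish s 2 s' \<and> regs s' 1 = regs s 2"
proof -
  let ?s = "set_reg M 5 0 s"
  have "regs s 2 mod 2 ^ w = regs s 2" using assms by (intro mod_w) linarith
  moreover have "exec M kmem_finish s (1 + 1)
      (set_reg M 1 (apply_op (word_length M) Add (regs ?s 2) (regs ?s 5)) ?s)"
    unfolding kmem_finish_def by (rule exec.Seq[OF exec.Const exec.Op])
  ultimately show ?thesis by (auto simp: set_reg_def numeral_2_eq_2)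
qed

lemma kmem_online:
  assumes U: "\<And>Q a b. qt Q a b \<le> U" and d: "r \<le> 2 ^ d" and P: "\<forall>a \<in> set P. a < 2 ^ w"
    and B: "real (112 + 6 * U + 10 * d) \<le> B"
  shows "finds_kmems_online M kmem_step kmem_finish k T P B"
proof -
  let ?K = "110 + 6 * U + 10 * d"
  define m where "m = length P"
  define Q where "Q i s ts \<longleftrightarrow> exec M kmem_step (set_reg M 0 (P ! i) s) (fst ts) (snd ts) \<and>
      fst ts \<le> ?K \<and> tracks (drop i P) (snd ts) \<and>
      regs (snd ts) 1 = (if mlen k T (drop (Suc i) P) < mlen k T (drop i P) then 0
        else mlen k T (drop (Suc i) P))" for i s ts
  have ex: "\<exists>ts. Q i s ts" if "i < m" "tracks (drop (Suc i) P) s" for i s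
  proof -
    have "drop i P = P ! i # drop (Suc i) P" using that by (simp add: m_def Cons_nth_drop_Suc)
    then show ?thesis
      using exec_kmem_step[OF U d that(2), of "P ! i"] P that(1) by (auto simp: Q_def m_def)
  qed
  \<comment> \<open>\<open>exec_kmem_step\<close> yields only existence, so a result is chosen for
    each step and the choices are iterated.\<close>
  define next_state where "next_state i s = (SOME ts. Q i s ts)" for i s
  have nxt: "Q i s (next_state i s)" if "i < m" "tracks (drop (Suc i) P) s" for i s
    unfolding next_state_def using someI_ex[OF ex[OF that]] .
  let ?init = "\<lparr>regs = (\<lambda>_. 0), mem = (\<lambda>_. 0)\<rparr>"
  \<comment> \<open>\<open>F e\<close> is the state after the last \<open>e\<close> symbols of
    \<open>P\<close>; \<open>S\<close> reindexes it by pattern position.\<close>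
  define F where "F = rec_nat ?init (\<lambda>e s. snd (next_state (m - Suc e) s))"
  define S where "S i = F (m - i)" for i
  have S_m: "S m = ?init" by (simp add: S_def F_def)
  have S_Suc: "S i = snd (next_state i (S (Suc i)))" if "i < m" for i
  proof -
    have "m - i = Suc (m - Suc i)" "m - Suc (m - Suc i) = i" using that by auto
    then show ?thesis by (simp add: S_def F_def)
  qed
  have tr: "tracks (drop i P) (S i)" if "i \<le> m" for i
    using that
  proof (induction i rule: inc_induct)
    case base
    have "mlen k T [] = 0" using mlen_le_length[of k T "[]"] by simp
    then show ?case by (simp add: S_m tracks_def) (simp add: m_def)
  next
    case (step i)
    then show ?case using nxt[of i "S (Suc i)"] S_Suc[of i] by (simp add: Q_def)
  qed
  define t where "t i = (if i < m then fst (next_state i (S (Suc i))) else 0)" for i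
  have st: "Q i (S (Suc i)) (t i, S i)" if "i < m" for i
    using nxt[of i "S (Suc i)"] tr[of "Suc i"] that S_Suc[of i] by (simp add: t_def)
  have S0: "regs (S 0) 2 = mlen k T P" using tr[of 0] by (simp add: tracks_def)
  then obtain s_end where fin: "exec M kmem_finish (S 0) 2 s_end" "regs s_end 1 = mlen k T P"
    using exec_kmem_finish[of "S 0"] mlen_le_length_text[OF k_pos, of T P] by auto
  define ans where "ans i = (case i of 0 \<Rightarrow> regs s_end 1 | Suc i' \<Rightarrow> regs (S i') 1)" for i
  define time where "time i = t i + (if i = 0 then 2 else 0)" for i
  have "online_run M kmem_step kmem_finish P ans time"
    unfolding online_run_def
    by (rule exI[of _ S], rule exI[of _ t], rule exI[of _ s_end], rule exI[of _ 2])
      (use S_m st fin in \<open>auto simp: m_def Q_def ans_def time_def\<close>)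
  moreover have "correct_answer k T P i (ans i)" if "i < length P" for i
  proof (rule correct_answerI[OF that])
    show "ans i = (if 0 < i \<and> mlen k T (drop i P) < mlen k T (drop (i - 1) P) then 0
          else mlen k T (drop i P))"
      using st[of "i - 1"] that fin by (cases i) (auto simp: ans_def Q_def m_def)
  qed
  moreover have tb: "real (time i) \<le> B" for i
  proof -
    have "t i \<le> ?K" using st[of i] by (cases "i < m") (auto simp: Q_def t_def)
    then have "time i \<le> 112 + 6 * U + 10 * d" unfolding time_def by (cases "i = 0") simp_all
    then have "real (time i) \<le> real (112 + 6 * U + 10 * d)" by (rule of_nat_mono)
    then show ?thesis using B by linarith
  qed
  moreover have "real (\<Sum>i < length P. time i) \<le> real (length P) * B"
    using sum_bounded_above[of "{..<length P}" "\<lambda>i. real (time i)" B] tb by simp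
  ultimately show ?thesis unfolding finds_kmems_online_def by blast
qed

end

section \<open>Constants in the space and time bounds\<close>

lemma moni_added_kmems:
  fixes c1 cq :: real
  assumes is_text: "is_text T" and k: "1 \<le> k"
    and w: "6 * lg (length T) \<le> real w" "real w \<le> c1 * lg (length T)"
    and qt: "\<And>Q a b. real (qt Q a b) \<le> cq * lg (length T)"
  shows "\<exists>D. (\<forall>d \<in> set D. d < 2 ^ w) \<and>
    real (length D * w) \<le> max (9 * c1) (132 + 6 * cq) * (real (num_runs T) * lg (length T)) \<and>
    (\<forall>P. (\<forall>a \<in> set P. a < 2 ^ w) \<longrightarrow>
      finds_kmems_online (moni w T qt D) kmem_step kmem_finish k T P
        (max (9 * c1) (132 + 6 * cq) * lg (length T)))"
proof -
  let ?n = "length T"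
  let ?C = "max (9 * c1) (132 + 6 * cq)"
  have n: "0 < ?n" using is_text by (simp add: is_text_def)
  have lg: "1 \<le> lg ?n" "log 2 ?n \<le> lg ?n" by (simp_all add: lg_def)
  \<comment> \<open>The factor 6 on the word length comes from
    \<open>5 + log 2 n <= 6 * lg n\<close>, where \<open>lg n >= 1\<close> absorbs the 5.\<close>
  have "32 * real ?n = 2 powr (5 + log 2 ?n)" using n by (simp add: powr_add)
  also have "\<dots> \<le> 2 powr w" using lg w by (intro powr_mono) linarith+
  finally have "real (32 * ?n) \<le> real (2 ^ w)" by (simp add: powr_realpow)
  then have w32: "32 * ?n \<le> 2 ^ w" by (simp only: of_nat_le_iff)
  interpret moni_machine T k w qt
    by standard (use is_text k w32 in auto)
  define U where "U = nat \<lfloor>cq * lg ?n\<rfloor>"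
  have qtU: "qt Q a b \<le> U" for Q a b unfolding U_def using qt by (simp add: le_nat_floor)
  \<comment> \<open>Nonnegativity follows from the bound on any single query time; it makes the
    conversion to \<open>nat\<close> in \<open>U\<close> harmless.\<close>
  have "0 \<le> cq * lg ?n" using qt[of LCE 0 0] of_nat_0_le_iff order_trans by blast
  then have U: "real U \<le> cq * lg ?n" unfolding U_def by (simp add: of_nat_floor)
  define d where "d = nat \<lceil>log 2 ?n\<rceil>"
  have "1 \<le> real ?n" using n by linarith
  then have log0: "0 \<le> log 2 ?n" by (subst zero_le_log_cancel_iff) auto
  have "real ?n = 2 powr (log 2 ?n)" using n by simp
  also have "\<dots> \<le> 2 powr real d" unfolding d_def by (intro powr_mono) (simp_all add: real_nat_ceiling_ge)
  finally have "real ?n \<le> real (2 ^ d)" by (simp add: powr_realpow)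
  then have rd: "r \<le> 2 ^ d" using r_le_n by (simp only: of_nat_le_iff)
  \<comment> \<open>Rounding up adds at most 1, which is at most \<open>lg n\<close>. So the search
    contributes 20 to the constant, and \<open>132 = 112 + 20\<close>.\<close>
  have d: "real d \<le> 2 * lg ?n"
    unfolding d_def using log0 lg of_int_ceiling_le_add_one[of "log 2 ?n"] by linarith
  show "\<exists>D. (\<forall>d \<in> set D. d < 2 ^ w) \<and>
           real (length D * w) \<le> ?C * (real (num_runs T) * lg ?n) \<and>
           (\<forall>P. (\<forall>a \<in> set P. a < 2 ^ w) \<longrightarrow>
              finds_kmems_online (moni w T qt D) kmem_step kmem_finish k T P (?C * lg ?n))"
  proof (intro exI[of _ added] conjI allI impI ballI)
    fix x assume "x \<in> set added"
    then obtain i where "i < length added" "x = added ! i" by (auto simp only: in_set_conv_nth)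
    then have "x \<le> Suc ?n" using lookup_added_le[of i] by (simp add: lookup_def)
    then show "x < 2 ^ w" using w32 n by linarith
  next
    have "real (length added * w) = 9 * real r * real w" by simp
    also have "\<dots> \<le> 9 * real r * (c1 * lg ?n)" using w by (intro mult_left_mono) auto
    also have "\<dots> = 9 * c1 * (real r * lg ?n)" by simp
    also have "\<dots> \<le> ?C * (real r * lg ?n)" using lg by (intro mult_right_mono) auto
    finally show "real (length added * w) \<le> ?C * (real r * lg ?n)" .
  next
    fix P :: "nat list" assume P: "\<forall>a \<in> set P. a < 2 ^ w"
    have "real (112 + 6 * U + 10 * d) \<le> 112 * lg ?n + 6 * (cq * lg ?n) + 10 * (2 * lg ?n)"
      using U d lg by simp
    also have "\<dots> = (132 + 6 * cq) * lg ?n" by (simp add: algebra_simps)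
    also have "\<dots> \<le> ?C * lg ?n" using lg by (intro mult_right_mono) auto
    finally show "finds_kmems_online M kmem_step kmem_finish k T P (?C * lg ?n)"
      by (rule kmem_online[OF qtU rd P])
  qed
qed

theorem theorem3:
  shows "\<exists>(step :: prog) (finish :: prog) (c0 :: real).
    \<forall>(c1 :: real) (cq :: real). \<exists>C :: real.
      \<forall>(T :: nat list) (k :: nat) (w :: nat) (qt :: query \<Rightarrow> nat \<Rightarrow> nat \<Rightarrow> nat).
        is_text T \<and> 1 \<le> k \<and>
        c0 * lg (length T) \<le> real w \<and> real w \<le> c1 * lg (length T) \<and>
        (\<forall>a \<in> set T. a < 2 ^ w) \<and>
        (\<forall>Q a b. real (qt Q a b) \<le> cq * lg (length T))
        \<longrightarrow>
        (\<exists>D :: nat list.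
           (\<forall>d \<in> set D. d < 2 ^ w) \<and>
           real (length D * w) \<le> C * (real (num_runs T) * lg (length T)) \<and>
           (\<forall>P :: nat list. (\<forall>a \<in> set P. a < 2 ^ w) \<longrightarrow>
              finds_kmems_online (moni w T qt D) step finish k T P (C * lg (length T))))"
proof -
  \<comment> \<open>The constant is built from \<open>c1\<close> and \<open>cq\<close> alone and is
    thus uniform in \<open>T\<close> and \<open>k\<close>.\<close>
  have bounds: "\<exists>C. \<forall>T k w qt.
        is_text T \<and> 1 \<le> k \<and>
        6 * lg (length T) \<le> real w \<and> real w \<le> c1 * lg (length T) \<and>
        (\<forall>a \<in> set T. a < 2 ^ w) \<and>
        (\<forall>Q a b. real (qt Q a b) \<le> cq * lg (length T))
        \<longrightarrow>
        (\<exists>D :: nat list.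
           (\<forall>d \<in> set D. d < 2 ^ w) \<and>
           real (length D * w) \<le> C * (real (num_runs T) * lg (length T)) \<and>
           (\<forall>P :: nat list. (\<forall>a \<in> set P. a < 2 ^ w) \<longrightarrow>
              finds_kmems_online (moni w T qt D) kmem_step kmem_finish k T P (C * lg (length T))))"
    for c1 cq
    by (intro exI[of _ "max (9 * c1) (132 + 6 * cq)"] allI impI, elim conjE)
      (rule moni_added_kmems, simp_all)
  show ?thesis
    by (rule exI[of _ kmem_step], rule exI[of _ kmem_finish], rule exI[of _ 6], intro allI)
      (rule bounds)
qed

end
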